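(* Let $p$ be a prime and let $${\mathcal D\mathcal L}=(\mathbb Z/p[\![x]\!]\oplus\mathbb Z/p[\![x]\!])\rtimes(C\otimes\mathbb Z_p)$$ be the double lamplighter pro-$p$-group. Then the kernel of the comparison homomorphism $$\varphi: H_2^{\sf disc}({\mathcal D\mathcal L},\mathbb Z/p)\longrightarrow H_2^{\sf cont}({\mathcal D\mathcal L},\mathbb Z/p)$$ is uncountable.
   Context: $C=\langle t\rangle$ is infinite cyclic and $C\otimes\mathbb Z_p=\{t^\alpha:\alpha\in\mathbb Z_p\}$ is the group of $p$-adic integers written multiplicatively; it acts on each copy of $\mathbb Z/p[\![x]\!]$ by multiplication by $(1-x)^\alpha$ (the continuous extension of the action of $t$ by multiplication by $1-x$). ${\mathcal D\mathcal L}$ is the pro-$p$-completion of the double lamplighter group $(\mathbb Z/p[C]\oplus\mathbb Z/p[C])\rtimes C=\langle a,b,c\mid [b,b^{a^i}]=[c,c^{a^i}]=[b,c^{a^i}]=b^p=c^p=1,\ i\in\mathbb Z\rangle$. For a profinite group $G$, $H_2^{\sf disc}(G,\mathbb Z/p)$ is the homology of $G$ as a discrete group, $H_2^{\sf cont}(G,\mathbb Z/p)=\varprojlim_U H_2(G/U,\mathbb Z/p)$ over open normal subgroups $U$, and $\varphi$ is the inverse limit of the maps induced by the projections $G\to G/U$. *)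

theory Defs
  imports "HOL-Computational_Algebra.Primes" "HOL-Library.Countable_Set" "HOL-Algebra.Coset"
begin

text \<open>Chains with coefficients in Z/p are represented by finitely supported integer-valued
functions, read modulo p (all cycle/boundary conditions are congruences mod p).\<close>

definition supp :: "('x \<Rightarrow> int) \<Rightarrow> 'x set" where
  "supp z = {q. z q \<noteq> 0}"

definition chains2 :: "('a, 'b) monoid_scheme \<Rightarrow> ('a \<times> 'a \<Rightarrow> int) set" where
  "chains2 G = {z. finite (supp z) \<and> supp z \<subseteq> carrier G \<times> carrier G}"

definition chains3 :: "('a, 'b) monoid_scheme \<Rightarrow> ('a \<times> 'a \<times> 'a \<Rightarrow> int) set" where
  "chains3 G = {c. finite (supp c) \<and> supp c \<subseteq> carrier G \<times> carrier G \<times> carrier G}"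

text \<open>Bar differential d2 (g,h) = h - gh + g (trivial coefficients).\<close>
definition d2 :: "('a, 'b) monoid_scheme \<Rightarrow> ('a \<times> 'a \<Rightarrow> int) \<Rightarrow> 'a \<Rightarrow> int" where
  "d2 G z y = (\<Sum>q\<in>supp z. z q *
      ((if snd q = y then 1 else 0) - (if fst q \<otimes>\<^bsub>G\<^esub> snd q = y then 1 else 0)
       + (if fst q = y then 1 else 0)))"

text \<open>Bar differential d3 (g,h,k) = (h,k) - (gh,k) + (g,hk) - (g,h).\<close>
definition d3 :: "('a, 'b) monoid_scheme \<Rightarrow> ('a \<times> 'a \<times> 'a \<Rightarrow> int) \<Rightarrow> 'a \<times> 'a \<Rightarrow> int" where
  "d3 G c y = (\<Sum>q\<in>supp c. (case q of (g, h, k) \<Rightarrow> c q *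
      ((if (h, k) = y then 1 else 0) - (if (g \<otimes>\<^bsub>G\<^esub> h, k) = y then 1 else 0)
       + (if (g, h \<otimes>\<^bsub>G\<^esub> k) = y then 1 else 0) - (if (g, h) = y then 1 else 0))))"

definition is_cycle2 :: "('a, 'b) monoid_scheme \<Rightarrow> int \<Rightarrow> ('a \<times> 'a \<Rightarrow> int) \<Rightarrow> bool" where
  "is_cycle2 G p z \<longleftrightarrow> z \<in> chains2 G \<and> (\<forall>y. p dvd d2 G z y)"

definition is_boundary2 :: "('a, 'b) monoid_scheme \<Rightarrow> int \<Rightarrow> ('a \<times> 'a \<Rightarrow> int) \<Rightarrow> bool" where
  "is_boundary2 G p z \<longleftrightarrow> (\<exists>c\<in>chains3 G. \<forall>y. p dvd (z y - d3 G c y))"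

definition push2 :: "('a, 'b) monoid_scheme \<Rightarrow> 'a set \<Rightarrow> ('a \<times> 'a \<Rightarrow> int)
                      \<Rightarrow> 'a set \<times> 'a set \<Rightarrow> int" where
  "push2 G U z Q = (\<Sum>q\<in>supp z.
       if (U #>\<^bsub>G\<^esub> fst q, U #>\<^bsub>G\<^esub> snd q) = Q then z q else 0)"

text \<open>Cycles representing classes in the kernel of
  phi : H2disc(G,Z/p) \<rightarrow> lim_U H2(G/U,Z/p), U ranging over the given open normal subgroups.
  A class maps to zero in the inverse limit iff its image in every H2(G/U) vanishes.\<close>
definition ker_phi_cycles ::
    "('a, 'b) monoid_scheme \<Rightarrow> int \<Rightarrow> 'a set set \<Rightarrow> ('a \<times> 'a \<Rightarrow> int) set" where
  "ker_phi_cycles G p Opens =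
     {z. is_cycle2 G p z \<and> (\<forall>U\<in>Opens. is_boundary2 (G Mod U) p (push2 G U z))}"

definition homologous2 :: "('a, 'b) monoid_scheme \<Rightarrow> int \<Rightarrow> ('a \<times> 'a \<Rightarrow> int) set
                            \<Rightarrow> (('a \<times> 'a \<Rightarrow> int) \<times> ('a \<times> 'a \<Rightarrow> int)) set" where
  "homologous2 G p S = {(z, z'). z \<in> S \<and> z' \<in> S \<and> is_boundary2 G p (\<lambda>q. z q - z' q)}"

definition ker_phi :: "('a, 'b) monoid_scheme \<Rightarrow> int \<Rightarrow> 'a set set
                        \<Rightarrow> ('a \<times> 'a \<Rightarrow> int) set set" where
  "ker_phi G p Opens = ker_phi_cycles G p Opens // homologous2 G p (ker_phi_cycles G p Opens)"

definition padic :: "int \<Rightarrow> (nat \<Rightarrow> int) set" where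
  "padic p = {a. \<forall>n. 0 \<le> a n \<and> a n < p ^ n \<and> a (Suc n) mod p ^ n = a n}"

definition padd :: "int \<Rightarrow> (nat \<Rightarrow> int) \<Rightarrow> (nat \<Rightarrow> int) \<Rightarrow> nat \<Rightarrow> int" where
  "padd p a b = (\<lambda>n. (a n + b n) mod p ^ n)"

definition zpser :: "int \<Rightarrow> (nat \<Rightarrow> int) set" where
  "zpser p = {f. \<forall>k. 0 \<le> f k \<and> f k < p}"

definition sadd :: "int \<Rightarrow> (nat \<Rightarrow> int) \<Rightarrow> (nat \<Rightarrow> int) \<Rightarrow> nat \<Rightarrow> int" where
  "sadd p f g = (\<lambda>k. (f k + g k) mod p)"

definition smul :: "int \<Rightarrow> (nat \<Rightarrow> int) \<Rightarrow> (nat \<Rightarrow> int) \<Rightarrow> nat \<Rightarrow> int" where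
  "smul p u f = (\<lambda>n. (\<Sum>i\<le>n. u i * f (n - i)) mod p)"

definition one_minus_x :: "int \<Rightarrow> nat \<Rightarrow> int" where
  "one_minus_x p = (\<lambda>k. (if k = 0 then 1 else if k = 1 then -1 else 0) mod p)"

definition sone :: "int \<Rightarrow> nat \<Rightarrow> int" where
  "sone p = (\<lambda>k. (if k = 0 then 1 else 0) mod p)"

definition spow :: "int \<Rightarrow> nat \<Rightarrow> nat \<Rightarrow> int" where
  "spow p m = (smul p (one_minus_x p) ^^ m) (sone p)"

text \<open>(1-x)^alpha for a p-adic alpha, the continuous extension: the coefficient of x^k only
  depends on alpha mod p^(k+1) (since p^(k+1) > k), so it equals the coefficient of x^k in
  (1-x)^(a (k+1)).\<close>
definition tpow :: "int \<Rightarrow> (nat \<Rightarrow> int) \<Rightarrow> nat \<Rightarrow> int" where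
  "tpow p a = (\<lambda>k. spow p (nat (a (Suc k))) k)"

type_synonym dl_elem = "(nat \<Rightarrow> int) \<times> (nat \<Rightarrow> int) \<times> (nat \<Rightarrow> int)"

text \<open>(Z/p[[x]] + Z/p[[x]]) \<rtimes> (C \<otimes> Z_p), with t^alpha acting by multiplication
  by (1-x)^alpha on both copies.\<close>
definition DL_mult :: "int \<Rightarrow> dl_elem \<Rightarrow> dl_elem \<Rightarrow> dl_elem" where
  "DL_mult p x y = (case x of (f1, g1, a1) \<Rightarrow> case y of (f2, g2, a2) \<Rightarrow>
                     (sadd p f1 (smul p (tpow p a1) f2),
                      sadd p g1 (smul p (tpow p a1) g2),
                      padd p a1 a2))"

definition DL :: "int \<Rightarrow> dl_elem monoid" where
  "DL p = \<lparr>carrier = zpser p \<times> zpser p \<times> padic p,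
           mult = DL_mult p,
           one = ((\<lambda>_. 0), (\<lambda>_. 0), (\<lambda>_. 0))\<rparr>"

text \<open>Basic open neighbourhoods of the identity for the product (profinite) topology:
  x^n Z/p[[x]] + x^n Z/p[[x]] + p^n Z_p.\<close>
definition DL_basic :: "int \<Rightarrow> nat \<Rightarrow> dl_elem set" where
  "DL_basic p n = {(f, g, a) \<in> carrier (DL p). (\<forall>k<n. f k = 0 \<and> g k = 0) \<and> a n = 0}"

definition DL_open_normal :: "int \<Rightarrow> dl_elem set set" where
  "DL_open_normal p = {U. U \<lhd> DL p \<and> (\<exists>n. DL_basic p n \<subseteq> U)}"

end

theory Submission
  imports Defs "HOL-Computational_Algebra.Formal_Power_Series"
begin

text \<open>
  Write \<open>M = Z/p[[x]]\<close> and \<open>y = 1 - x\<close>. For commuting \<open>g, h\<close> put \<open>{g, h} = (g, h) - (h, g)\<close>.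
  Identifying the two copies of \<open>M\<close> with subgroups of the group, \<open>f \<otimes> g \<mapsto> {f, g}\<close> maps the tensor
  product of \<open>M\<close> with itself over the group ring of \<open>C \<otimes> Z_p\<close> (acting on the second factor through
  the involution \<open>\<tau>: y \<mapsto> 1/y\<close>) to the second homology. The cycle \<open>{f, 1} - {1, \<tau> f}\<close> dies in every
  finite quotient, since there \<open>f\<close> may be replaced by a polynomial in \<open>y\<close>, which can be moved
  across the tensor sign.

  Let \<open>R\<close> be the span of the \<open>y^\<alpha>\<close> with \<open>\<alpha>\<close> a \<open>p\<close>-adic integer. The series \<open>\<lambda> = \<Sum>k. x^(p^k)\<close> is
  not in the fraction field of \<open>R\<close>: modulo \<open>x^(p^N)\<close> it is \<open>\<Sum>k<N. (1 - y^(p^k))\<close>, and in the group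
  ring of \<open>Z/p^N\<close> the support of its product with a fixed nonzero element of \<open>R\<close> grows with \<open>N\<close>,
  unlike that of an element of \<open>R\<close>. Zorn's lemma therefore yields an \<open>R\<close>-linear map \<open>T\<close> from \<open>M\<close> to
  the fraction field of \<open>R\<close> with \<open>T 1 = 0\<close> and \<open>T \<lambda> = 1\<close>. Then
  \<open>((f, _, \<alpha>), (_, g, _)) \<mapsto> T f \<cdot> \<tau> (y^\<alpha> g)\<close> is a 2-cocycle of the discrete group whose values
  \<open>y^\<alpha>\<close> on the cycles with \<open>f = y^\<alpha> \<lambda>\<close> are pairwise distinct.
\<close>

unbundle fps_syntax

section \<open>Power series modulo p\<close>

text \<open>Elements of \<open>Z/p[[x]]\<close> are represented by integer power series, considered modulo
  divisibility by \<open>of_int p\<close>.\<close>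

definition vanish :: "int \<Rightarrow> nat \<Rightarrow> int fps \<Rightarrow> bool" where
  "vanish p n F \<longleftrightarrow> (\<forall>k<n. p dvd F $ k)"

definition red :: "int \<Rightarrow> int fps \<Rightarrow> nat \<Rightarrow> int" where
  "red p F = (\<lambda>k. F $ k mod p)"

text \<open>The substituted series is \<open>-x/(1-x) = 1 - 1/(1-x)\<close>, so \<open>1 - x\<close> goes to its inverse.\<close>

definition twist :: "int fps \<Rightarrow> int fps" where
  "twist F = fps_compose F (Abs_fps (\<lambda>k. if k = 0 then 0 else -1))"

definition tpow_fps :: "int \<Rightarrow> (nat \<Rightarrow> int) \<Rightarrow> int fps" where
  "tpow_fps p a = Abs_fps (tpow p a)"

lemma of_int_dvd_fps_iff: "(of_int p :: int fps) dvd F \<longleftrightarrow> (\<forall>k. p dvd F $ k)"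
proof
  assume "(of_int p :: int fps) dvd F"
  then obtain G where "F = of_int p * G" by (auto simp: dvd_def)
  then show "\<forall>k. p dvd F $ k" by (simp flip: fps_of_int)
next
  assume "\<forall>k. p dvd F $ k"
  then have "F = of_int p * Abs_fps (\<lambda>k. F $ k div p)"
    by (simp add: fps_eq_iff flip: fps_of_int)
  then show "(of_int p :: int fps) dvd F" by (metis dvd_triv_left)
qed

lemma dvd_iff_vanish: "(of_int p :: int fps) dvd F \<longleftrightarrow> (\<forall>n. vanish p n F)"
  unfolding of_int_dvd_fps_iff vanish_def by blast

lemma vanish_add: "vanish p n F \<Longrightarrow> vanish p n G \<Longrightarrow> vanish p n (F + G)"
  by (simp add: vanish_def)

lemma vanish_diff: "vanish p n F \<Longrightarrow> vanish p n G \<Longrightarrow> vanish p n (F - G)"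
  by (simp add: vanish_def)

lemma vanish_uminus: "vanish p n F \<Longrightarrow> vanish p n (- F)"
  by (simp add: vanish_def)

lemma vanish_mult: "vanish p n F \<Longrightarrow> vanish p n (G * F)"
  by (auto simp: vanish_def fps_mult_nth intro!: dvd_sum)

lemma vanish_mult2: "vanish p n F \<Longrightarrow> vanish p n (F * G)"
  using vanish_mult[of p n F G] by (simp add: mult.commute)

lemma vanish_sum: "(\<And>i. i \<in> A \<Longrightarrow> vanish p n (F i)) \<Longrightarrow> vanish p n (sum F A)"
  by (auto simp: vanish_def fps_sum_nth intro!: dvd_sum)

lemma vanish_mono: "vanish p n F \<Longrightarrow> m \<le> n \<Longrightarrow> vanish p m F"
  by (simp add: vanish_def)

lemma vanish_dvd: "(of_int p :: int fps) dvd F \<Longrightarrow> vanish p n F"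
  by (simp add: dvd_iff_vanish)

lemma vanish_trans: "vanish p n (F - G) \<Longrightarrow> vanish p n (G - H) \<Longrightarrow> vanish p n (F - H)"
  using vanish_add[of p n "F - G" "G - H"] by simp

lemma vanish_replace: "vanish p n (F - G - H) \<Longrightarrow> vanish p n (G - G') \<Longrightarrow> vanish p n (F - G' - H)"
  using vanish_add[of p n "F - G - H" "G - G'"] by (simp add: algebra_simps)

lemma vanish_sym: "vanish p n (F - G) \<Longrightarrow> vanish p n (G - F)"
  using vanish_uminus[of p n "F - G"] by simp

lemma vanish_cong_mult:
  assumes "vanish p n (F - F')" "vanish p n (G - G')"
  shows "vanish p n (F * G - F' * G')"
proof -
  have "F * G - F' * G' = (F - F') * G + F' * (G - G')" by (simp add: algebra_simps)
  then show ?thesis using assms by (metis vanish_add vanish_mult vanish_mult2)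
qed

lemma red_eq_iff: "red p F = red p G \<longleftrightarrow> (of_int p :: int fps) dvd F - G"
  by (simp add: red_def fun_eq_iff of_int_dvd_fps_iff mod_eq_dvd_iff)

lemma sadd_red [simp]: "sadd p (red p F) (red p G) = red p (F + G)"
  by (simp add: sadd_def red_def fun_eq_iff mod_add_eq)

lemma smul_red [simp]: "smul p (red p F) (red p G) = red p (F * G)"
proof
  fix n
  have "smul p (red p F) (red p G) n = (\<Sum>i\<le>n. (F $ i mod p) * (G $ (n - i) mod p) mod p) mod p"
    by (simp add: smul_def red_def mod_sum_eq)
  also have "\<dots> = (\<Sum>i\<le>n. F $ i * G $ (n - i)) mod p"
    by (simp add: mod_mult_eq mod_sum_eq)
  finally show "smul p (red p F) (red p G) n = red p (F * G) n"
    by (simp add: red_def fps_mult_nth atMost_atLeast0)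
qed

lemma one_minus_x_red: "one_minus_x p = red p (1 - fps_X)"
  by (auto simp: one_minus_x_def red_def fun_eq_iff)

lemma sone_red: "sone p = red p 1"
  by (auto simp: sone_def red_def fun_eq_iff)

lemma spow_red: "spow p m = red p ((1 - fps_X) ^ m)"
  by (induction m) (simp_all add: spow_def sone_red one_minus_x_red)

lemma red_Abs_fps: "f \<in> zpser p \<Longrightarrow> red p (Abs_fps f) = f"
  by (auto simp: red_def zpser_def fun_eq_iff)

lemma red_zpser: "p > 0 \<Longrightarrow> red p F \<in> zpser p"
  by (simp add: red_def zpser_def)

lemma vanish_twist: "vanish p n F \<Longrightarrow> vanish p n (twist F)"
  by (auto simp: vanish_def twist_def fps_compose_nth intro!: dvd_sum)

lemma twist_add: "twist (F + G) = twist F + twist G"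
  by (simp add: twist_def fps_compose_add_distrib)

lemma twist_diff: "twist (F - G) = twist F - twist G"
  by (simp add: twist_def fps_compose_sub_distrib)

lemma twist_mult: "twist (F * G) = twist F * twist G"
  by (simp add: twist_def fps_compose_mult_distrib)

lemma twist_1 [simp]: "twist 1 = 1"
  by (simp add: twist_def)

lemma twist_0 [simp]: "twist 0 = 0"
  by (simp add: twist_def)

lemma twist_power: "twist (F ^ n) = twist F ^ n"
  by (induction n) (simp_all add: twist_mult)

lemma twist_dvd: "(of_int p :: int fps) dvd F \<Longrightarrow> (of_int p :: int fps) dvd twist F"
  by (simp add: dvd_iff_vanish vanish_twist)

lemma twist_one_minus_X: "(1 - fps_X) * twist (1 - fps_X) = 1"
proof -
  have "twist (1 - fps_X) = Abs_fps (\<lambda>_. 1)"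
    by (simp add: twist_def fps_compose_sub_distrib fps_eq_iff)
  then show ?thesis
    by (simp add: left_diff_distrib fps_eq_iff)
qed

lemma diff_dvd_power_diff: "(x :: 'a :: comm_ring_1) - y dvd x ^ n - y ^ n"
proof (induction n)
  case (Suc n)
  have "x ^ Suc n - y ^ Suc n = x * (x ^ n - y ^ n) + (x - y) * y ^ n"
    by (simp add: algebra_simps)
  then show ?case using Suc by simp
qed simp

definition cong_fps :: "int \<Rightarrow> int fps \<Rightarrow> int fps \<Rightarrow> bool" where
  "cong_fps p F G \<longleftrightarrow> (of_int p :: int fps) dvd F - G"

lemma cong_fps_refl: "cong_fps p F F"
  by (simp add: cong_fps_def)

lemma cong_fps_sym: "cong_fps p F G \<Longrightarrow> cong_fps p G F"
  unfolding cong_fps_def by (metis dvd_minus_iff minus_diff_eq)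

lemma cong_fps_trans [trans]: "cong_fps p F G \<Longrightarrow> cong_fps p G H \<Longrightarrow> cong_fps p F H"
  unfolding cong_fps_def by (drule (1) dvd_add) simp

lemma cong_fps_add: "cong_fps p F F' \<Longrightarrow> cong_fps p G G' \<Longrightarrow> cong_fps p (F + G) (F' + G')"
  unfolding cong_fps_def by (drule (1) dvd_add) (simp add: algebra_simps)

lemma cong_fps_diff: "cong_fps p F F' \<Longrightarrow> cong_fps p G G' \<Longrightarrow> cong_fps p (F - G) (F' - G')"
  unfolding cong_fps_def by (drule (1) dvd_diff) (simp add: algebra_simps)

lemma cong_fps_mult: "cong_fps p F F' \<Longrightarrow> cong_fps p G G' \<Longrightarrow> cong_fps p (F * G) (F' * G')"
proof -
  assume "cong_fps p F F'" "cong_fps p G G'"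
  then have "(of_int p :: int fps) dvd (F - F') * G + F' * (G - G')"
    unfolding cong_fps_def by (intro dvd_add dvd_mult dvd_mult2)
  then show ?thesis by (simp add: cong_fps_def algebra_simps)
qed

lemma cong_fps_twist: "cong_fps p F G \<Longrightarrow> cong_fps p (twist F) (twist G)"
  using twist_dvd[of p "F - G"] by (simp add: cong_fps_def twist_diff)

lemma cong_fps_red: "cong_fps p (Abs_fps (red p F)) F"
  by (simp add: cong_fps_def of_int_dvd_fps_iff red_def mod_eq_dvd_iff[symmetric])

section \<open>Frobenius and powers of \<open>1 - x\<close> modulo \<open>p\<close>\<close>

locale prime_modulus =
  fixes p :: int
  assumes p: "prime p"
begin

lemma p_gt_1: "p > 1"
  using p prime_gt_1_int by blast

text \<open>The inner binomial coefficients of the \<open>p\<close>-th power are divisible by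
  \<open>p\<close>. A monomial stands in place of \<open>x\<close> so that the congruence can be
  iterated.\<close>

lemma frobenius_one_minus_monomial:
  "(of_int p :: int fps) dvd (1 - fps_X ^ m) ^ nat p - (1 - fps_X ^ (m * nat p))"
proof -
  define q where "q = nat p"
  have q: "prime q" "int q = p" "q > 0"
    using p p_gt_1 unfolding q_def by (blast dest: prime_int_nat_transfer[THEN iffD1], linarith, linarith)
  define A :: "int fps" where "A = - (fps_X ^ m)"
  have "(A + 1) ^ q = (\<Sum>k\<le>q. of_nat (q choose k) * A ^ k)"
    by (simp add: binomial_ring)
  also have "{..q} = insert 0 (insert q {0<..<q})" using q by auto
  also have "(\<Sum>k\<in>\<dots>. of_nat (q choose k) * A ^ k) = 1 + A ^ q + (\<Sum>k\<in>{0<..<q}. of_nat (q choose k) * A ^ k)"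
    using q by simp
  finally have e: "(A + 1) ^ q - (1 + A ^ q) = (\<Sum>k\<in>{0<..<q}. of_nat (q choose k) * A ^ k)" by simp
  have "(of_int p :: int fps) dvd (\<Sum>k\<in>{0<..<q}. of_nat (q choose k) * A ^ k)"
  proof (rule dvd_sum)
    fix k assume "k \<in> {0<..<q}"
    then have "q dvd (q choose k)" using q by (intro dvd_choose_prime) auto
    then have "(of_nat q :: int fps) dvd of_nat (q choose k)" by (metis dvd_def of_nat_mult)
    then show "(of_int p :: int fps) dvd of_nat (q choose k) * A ^ k"
      using q(2) by (metis dvd_mult2 of_int_of_nat_eq)
  qed
  then have 1: "(of_int p :: int fps) dvd (A + 1) ^ q - (1 + A ^ q)" by (simp only: e)
  \<comment> \<open>For odd \<open>q\<close> the sign survives the power and the sum is 0; for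
    \<open>q = 2\<close> it is twice a monomial, again divisible by \<open>p\<close>.\<close>
  have 2: "(of_int p :: int fps) dvd A ^ q + fps_X ^ (m * q)"
  proof (cases "q = 2")
    case True
    then have "A ^ q + fps_X ^ (m * q) = of_int p * fps_X ^ (m * q)"
      using q(2) by (auto simp: A_def power_mult power2_eq_square)
    then show ?thesis by simp
  next
    case False
    then have "odd q" using q(1) primes_dvd_imp_eq two_is_prime_nat by blast
    then show ?thesis by (simp add: A_def power_mult)
  qed
  have "(of_int p :: int fps) dvd ((A + 1) ^ q - (1 + A ^ q)) + (A ^ q + fps_X ^ (m * q))"
    using 1 2 by (rule dvd_add)
  moreover have "((A + 1) ^ q - (1 + A ^ q)) + (A ^ q + fps_X ^ (m * q)) = (1 - fps_X ^ m) ^ q - (1 - fps_X ^ (m * q))"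
    by (simp add: A_def)
  ultimately show ?thesis unfolding q_def by metis
qed

lemma frobenius_one_minus_X:
  "(of_int p :: int fps) dvd (1 - fps_X) ^ (nat p ^ n) - (1 - fps_X ^ (nat p ^ n))"
proof (induction n)
  case (Suc n)
  let ?q = "nat p"
  have "(of_int p :: int fps) dvd ((1 - fps_X) ^ (?q ^ n)) ^ ?q - (1 - fps_X ^ (?q ^ n)) ^ ?q"
    by (rule dvd_trans[OF Suc diff_dvd_power_diff])
  from dvd_add[OF this frobenius_one_minus_monomial[of "?q ^ n"]] show ?case
    by (simp add: power_mult[symmetric] mult.commute algebra_simps)
qed simp

text \<open>Modulo \<open>p\<close> and \<open>x^(p^n)\<close> the element \<open>y = 1 - x\<close>
  behaves as a generator of a cyclic group of order \<open>p^n\<close>, so only exponents modulo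
  \<open>p^n\<close> matter there.\<close>

lemma vanish_one_minus_X_pow: "vanish p (nat p ^ n) ((1 - fps_X) ^ (nat p ^ n) - 1)"
proof -
  have "vanish p (nat p ^ n) (- (fps_X ^ (nat p ^ n)))"
    by (simp add: vanish_def)
  from vanish_add[OF vanish_dvd[OF frobenius_one_minus_X[of n]] this] show ?thesis by simp
qed

lemma vanish_one_minus_X_periodic:
  "vanish p (nat p ^ n) ((1 - fps_X) ^ (i + nat p ^ n * j) - (1 - fps_X) ^ i)"
proof -
  let ?u = "(1 - fps_X :: int fps) ^ (nat p ^ n)"
  have "?u - 1 dvd ?u ^ j - 1" using diff_dvd_power_diff[of ?u 1 j] by simp
  then obtain v where "?u ^ j - 1 = (?u - 1) * v" by (auto simp: dvd_def)
  then have "vanish p (nat p ^ n) (?u ^ j - 1)"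
    using vanish_mult2[OF vanish_one_minus_X_pow] by simp
  from vanish_mult[OF this, of "(1 - fps_X) ^ i"] show ?thesis
    by (simp only: power_add power_mult right_diff_distrib mult_1_right)
qed

lemma vanish_one_minus_X_cong:
  assumes "i mod nat p ^ n = j mod nat p ^ n"
  shows "vanish p (nat p ^ n) ((1 - fps_X) ^ i - (1 - fps_X) ^ j)"
proof -
  let ?q = "nat p ^ n"
  have "vanish p ?q ((1 - fps_X) ^ i - (1 - fps_X) ^ (i mod ?q))"
    using vanish_one_minus_X_periodic[of n "i mod ?q" "i div ?q"] by simp
  moreover have "vanish p ?q ((1 - fps_X) ^ (i mod ?q) - (1 - fps_X) ^ j)"
    using vanish_one_minus_X_periodic[of n "j mod ?q" "j div ?q"] assms vanish_sym by simp
  ultimately show ?thesis by (rule vanish_trans)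
qed

section \<open>Powers of \<open>1 - x\<close> with \<open>p\<close>-adic exponents\<close>

lemma padic_mod:
  assumes a: "a \<in> padic p" and "m \<le> n"
  shows "a n mod p ^ m = a m"
  using assms(2)
proof (induction n rule: dec_induct)
  case base
  then show ?case using a by (auto simp: padic_def)
next
  case (step n)
  have "p ^ m dvd p ^ n" using step.hyps by (simp add: le_imp_power_dvd)
  then have "a (Suc n) mod p ^ m = (a (Suc n) mod p ^ n) mod p ^ m" by (simp add: mod_mod_cancel)
  then show ?case using step.IH a by (auto simp: padic_def)
qed

lemma padic_nonneg: "a \<in> padic p \<Longrightarrow> 0 \<le> a n"
  by (auto simp: padic_def)

lemma padic_less: "a \<in> padic p \<Longrightarrow> nat (a n) < nat p ^ n"
proof -
  assume "a \<in> padic p"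
  then have "a n < int (nat p ^ n)" using p_gt_1 by (auto simp: padic_def)
  then show ?thesis using padic_nonneg[OF \<open>a \<in> padic p\<close>, of n] by linarith
qed

lemma nat_padic_mod:
  assumes "a \<in> padic p" "m \<le> n"
  shows "nat (a n) mod nat p ^ m = nat (a m)"
proof -
  have "nat (a n) mod nat p ^ m = nat (a n mod p ^ m)"
    using padic_nonneg[OF assms(1)] p_gt_1 by (simp add: nat_mod_distrib nat_power_eq)
  then show ?thesis using padic_mod[OF assms] by simp
qed

text \<open>Reduces identities between \<open>p\<close>-adic powers to integer exponents at each
  truncation level \<open>p^n\<close>; \<open>dvd_vanish_powers\<close> then reassembles the
  levels.\<close>

lemma tpow_fps_approx:
  assumes a: "a \<in> padic p"
  shows "vanish p (nat p ^ n) (tpow_fps p a - (1 - fps_X) ^ nat (a n))"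
  unfolding vanish_def
proof (intro allI impI)
  fix k assume k: "k < nat p ^ n"
  \<comment> \<open>Coefficient \<open>k\<close> of \<open>tpow\<close> is read off from
    \<open>a (Suc k)\<close>, not from \<open>a n\<close>. The two exponents agree modulo
    \<open>p^m\<close>, and \<open>k < p^m\<close> because \<open>k < p^n\<close> and
    \<open>k < p^(k+1)\<close>.\<close>
  define m where "m = min n (Suc k)"
  have q: "Suc 0 < nat p" using p_gt_1 by simp
  have "k < nat p ^ Suc k" using power_gt_expt[OF q, of "Suc k"] by simp
  with k have km: "k < nat p ^ m" by (simp add: m_def min_def)
  have "vanish p (nat p ^ m) ((1 - fps_X) ^ nat (a (Suc k)) - (1 - fps_X) ^ nat (a n))"
    using nat_padic_mod[OF a, of m n] nat_padic_mod[OF a, of m "Suc k"]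
    by (intro vanish_one_minus_X_cong) (simp add: m_def)
  with km have "p dvd ((1 - fps_X) ^ nat (a (Suc k))) $ k - ((1 - fps_X) ^ nat (a n)) $ k"
    by (auto simp: vanish_def)
  then have "p dvd ((1 - fps_X) ^ nat (a (Suc k))) $ k mod p - ((1 - fps_X) ^ nat (a n)) $ k"
    by (simp add: mod_eq_dvd_iff[symmetric])
  then show "p dvd (tpow_fps p a - (1 - fps_X) ^ nat (a n)) $ k"
    by (simp add: tpow_fps_def tpow_def spow_red red_def)
qed

lemma red_tpow_fps: "red p (tpow_fps p a) = tpow p a"
  by (simp add: fun_eq_iff red_def tpow_fps_def tpow_def spow_red)

lemma dvd_vanish_powers:
  assumes "\<And>n. vanish p (nat p ^ n) F"
  shows "(of_int p :: int fps) dvd F"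
  unfolding dvd_iff_vanish
proof
  fix n
  have "n \<le> nat p ^ n" using power_gt_expt[of "nat p" n] p_gt_1 by simp
  then show "vanish p n F" using assms vanish_mono by blast
qed

lemma padd_padic: "a \<in> padic p \<Longrightarrow> b \<in> padic p \<Longrightarrow> padd p a b \<in> padic p"
proof -
  assume a: "a \<in> padic p" and b: "b \<in> padic p"
  have "((a (Suc n) + b (Suc n)) mod (p * p ^ n)) mod p ^ n = (a n + b n) mod p ^ n" for n
  proof -
    have "((a (Suc n) + b (Suc n)) mod (p * p ^ n)) mod p ^ n = (a (Suc n) + b (Suc n)) mod p ^ n"
      by (simp add: mod_mod_cancel)
    also have "\<dots> = (a (Suc n) mod p ^ n + b (Suc n) mod p ^ n) mod p ^ n" by (simp add: mod_simps)
    finally show ?thesis using a b by (simp add: padic_def)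
  qed
  then show ?thesis using p_gt_1 by (simp add: padic_def padd_def)
qed

lemma tpow_fps_padd:
  assumes a: "a \<in> padic p" and b: "b \<in> padic p"
  shows "(of_int p :: int fps) dvd tpow_fps p (padd p a b) - tpow_fps p a * tpow_fps p b"
proof (rule dvd_vanish_powers)
  fix n
  let ?y = "1 - fps_X :: int fps"
  have ab: "padd p a b \<in> padic p" by (rule padd_padic[OF a b])
  have "nat ((a n + b n) mod p ^ n) = (nat (a n) + nat (b n)) mod nat p ^ n"
    using padic_nonneg[OF a, of n] padic_nonneg[OF b, of n] p_gt_1
    by (simp add: nat_mod_distrib nat_power_eq nat_add_distrib)
  then have "vanish p (nat p ^ n) (?y ^ nat (padd p a b n) - ?y ^ (nat (a n) + nat (b n)))"
    by (intro vanish_one_minus_X_cong) (simp add: padd_def)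
  with tpow_fps_approx[OF ab, of n] have "vanish p (nat p ^ n) (tpow_fps p (padd p a b) - ?y ^ (nat (a n) + nat (b n)))"
    by (rule vanish_trans)
  moreover have "vanish p (nat p ^ n) (?y ^ (nat (a n) + nat (b n)) - tpow_fps p a * tpow_fps p b)"
    unfolding power_add using tpow_fps_approx[OF a, of n] tpow_fps_approx[OF b, of n] vanish_cong_mult vanish_sym by blast
  ultimately show "vanish p (nat p ^ n) (tpow_fps p (padd p a b) - tpow_fps p a * tpow_fps p b)" by (rule vanish_trans)
qed

lemma tpow_fps_twist:
  assumes a: "a \<in> padic p"
  shows "(of_int p :: int fps) dvd tpow_fps p a * twist (tpow_fps p a) - 1"
proof (rule dvd_vanish_powers)
  fix n
  let ?m = "nat (a n)"
  have "vanish p (nat p ^ n) (tpow_fps p a * twist (tpow_fps p a) - (1 - fps_X) ^ ?m * twist ((1 - fps_X) ^ ?m))"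
    using tpow_fps_approx[OF a, of n] vanish_twist[OF tpow_fps_approx[OF a, of n]]
    by (intro vanish_cong_mult) (simp_all add: twist_diff)
  then show "vanish p (nat p ^ n) (tpow_fps p a * twist (tpow_fps p a) - 1)"
    by (simp add: twist_power twist_one_minus_X flip: power_mult_distrib)
qed

text \<open>The first coefficients of \<open>F\<close> and of \<open>G\<close> that are prime to
  \<open>p\<close> multiply to a coefficient of \<open>F * G\<close> modulo \<open>p\<close>, so
  \<open>Z/p[[x]]\<close> is a domain.\<close>

lemma prime_dvd_fps_mult:
  assumes "(of_int p :: int fps) dvd F * G"
  shows "(of_int p :: int fps) dvd F \<or> (of_int p :: int fps) dvd G"
proof (rule ccontr)
  assume "\<not> ?thesis"
  then have "\<exists>k. \<not> p dvd F $ k" "\<exists>k. \<not> p dvd G $ k" by (auto simp: of_int_dvd_fps_iff)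
  define m where "m = (LEAST k. \<not> p dvd F $ k)"
  define n where "n = (LEAST k. \<not> p dvd G $ k)"
  have m: "\<not> p dvd F $ m" "\<And>k. k < m \<Longrightarrow> p dvd F $ k"
    using LeastI_ex[OF \<open>\<exists>k. \<not> p dvd F $ k\<close>] not_less_Least by (auto simp: m_def)
  have n: "\<not> p dvd G $ n" "\<And>k. k < n \<Longrightarrow> p dvd G $ k"
    using LeastI_ex[OF \<open>\<exists>k. \<not> p dvd G $ k\<close>] not_less_Least by (auto simp: n_def)
  have "(F * G) $ (m + n) = (\<Sum>i\<in>insert m ({0..m+n} - {m}). F $ i * G $ (m + n - i))"
    by (simp add: fps_mult_nth insert_absorb)
  also have "\<dots> = F $ m * G $ n + (\<Sum>i\<in>{0..m+n} - {m}. F $ i * G $ (m + n - i))"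
    by (subst sum.insert) auto
  finally have e: "(F * G) $ (m + n) = F $ m * G $ n + (\<Sum>i\<in>{0..m+n} - {m}. F $ i * G $ (m + n - i))" .
  have "p dvd (\<Sum>i\<in>{0..m+n} - {m}. F $ i * G $ (m + n - i))"
  proof (rule dvd_sum)
    fix i assume "i \<in> {0..m+n} - {m}"
    then have "i < m \<or> m + n - i < n" by auto
    then show "p dvd F $ i * G $ (m + n - i)" using m(2) n(2) by auto
  qed
  moreover have "p dvd (F * G) $ (m + n)" using assms by (simp add: of_int_dvd_fps_iff)
  ultimately have "p dvd F $ m * G $ n" unfolding e by (simp add: dvd_add_left_iff)
  then show False using m(1) n(1) p prime_dvd_mult_iff by blast
qed

text \<open>Triangularity: \<open>y^i\<close> is a polynomial of degree \<open>i\<close> with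
  leading coefficient 1 or -1, so the top coefficient isolates the last \<open>w\<close>, and
  induction handles the rest.\<close>

lemma one_minus_X_powers_independent:
  fixes w :: "nat \<Rightarrow> int"
  assumes "vanish p n (\<Sum>i<n. of_int (w i) * (1 - fps_X) ^ i)" "i < n"
  shows "p dvd w i"
  using assms
proof (induction n arbitrary: i)
  case (Suc n)
  have z: "((1 - fps_X :: int fps) ^ i) $ n = (if i = n then (-1) ^ n else 0)" if "i \<le> n" for i n
    using that
  proof (induction i arbitrary: n)
    case (Suc i)
    then obtain n' where n': "n = Suc n'" by (cases n) auto
    have "((1 - fps_X :: int fps) ^ Suc i) $ n = ((1 - fps_X) ^ i) $ n - ((1 - fps_X) ^ i) $ n'"
      by (simp add: left_diff_distrib n')
    then show ?case using Suc n' by auto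
  qed auto
  have "(\<Sum>i<Suc n. of_int (w i) * (1 - fps_X) ^ i) $ n = (\<Sum>i<Suc n. w i * ((1 - fps_X) ^ i) $ n)"
    by (simp add: fps_sum_nth flip: fps_of_int)
  also have "\<dots> = (\<Sum>i<n. w i * ((1 - fps_X) ^ i) $ n) + w n * (-1) ^ n" using z by simp
  also have "(\<Sum>i<n. w i * ((1 - fps_X) ^ i) $ n) = 0" by (rule sum.neutral) (use z in auto)
  finally have "p dvd w n * (-1) ^ n" using Suc.prems(1) by (auto simp: vanish_def)
  then have wn: "p dvd w n" by (cases "even n") auto
  then have "(of_int p :: int fps) dvd of_int (w n) * (1 - fps_X) ^ n"
    by (metis dvd_def dvd_mult2 of_int_mult)
  then have "vanish p n (of_int (w n) * (1 - fps_X) ^ n)" by (rule vanish_dvd)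
  with vanish_mono[OF Suc.prems(1), of n]
  have "vanish p n (\<Sum>i<n. of_int (w i) * (1 - fps_X) ^ i)"
    using vanish_diff[of p n "\<Sum>i<Suc n. of_int (w i) * (1 - fps_X) ^ i" "of_int (w n) * (1 - fps_X) ^ n"] by simp
  then show ?case using Suc.IH wn Suc.prems(2) less_Suc_eq by auto
qed simp

end

section \<open>Sums of exponentials and a lacunary series\<close>

inductive_set expsums :: "int \<Rightarrow> int fps set" for p :: int where
  zero: "(of_int p :: int fps) dvd F \<Longrightarrow> F \<in> expsums p"
| add: "F \<in> expsums p \<Longrightarrow> a \<in> padic p \<Longrightarrow> F + of_int c * tpow_fps p a \<in> expsums p"

definition lacunary :: "int \<Rightarrow> int fps" where
  "lacunary p = Abs_fps (\<lambda>k. if \<exists>j. k = nat p ^ j then 1 else 0)"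

context prime_modulus
begin

lemma expsums_add_dvd:
  "F \<in> expsums p \<Longrightarrow> (of_int p :: int fps) dvd G \<Longrightarrow> F + G \<in> expsums p"
proof (induction rule: expsums.induct)
  case (add F a c)
  then have "(F + G) + of_int c * tpow_fps p a \<in> expsums p" by (blast intro: expsums.add)
  then show ?case by (simp add: algebra_simps)
qed (simp add: expsums.zero)

lemma expsums_cong:
  "F \<in> expsums p \<Longrightarrow> (of_int p :: int fps) dvd G - F \<Longrightarrow> G \<in> expsums p"
  using expsums_add_dvd[of F "G - F"] by simp

lemma expsums_add:
  assumes "F \<in> expsums p" "G \<in> expsums p"
  shows "F + G \<in> expsums p"
  using assms(2)
proof (induction rule: expsums.induct)
  case (zero G)
  then show ?case using assms(1) expsums_add_dvd by blast
next
  case (add G a c)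
  then have "(F + G) + of_int c * tpow_fps p a \<in> expsums p" by (blast intro: expsums.add)
  then show ?case by (simp add: algebra_simps)
qed

lemma tpow_fps_expsums: "a \<in> padic p \<Longrightarrow> tpow_fps p a \<in> expsums p"
  using expsums.add[of 0 p a 1] expsums.zero[of p 0] by simp

lemma zero_padic: "(\<lambda>_. 0) \<in> padic p"
  using p_gt_1 by (simp add: padic_def)

lemma tpow_fps_0: "(of_int p :: int fps) dvd tpow_fps p (\<lambda>_. 0) - 1"
  by (rule dvd_vanish_powers) (use tpow_fps_approx[OF zero_padic] in simp)

lemma one_expsums: "1 \<in> expsums p"
  by (rule expsums_cong[OF tpow_fps_expsums[OF zero_padic]]) (metis tpow_fps_0 dvd_minus_iff minus_diff_eq)

lemma expsums_of_int_mult: "F \<in> expsums p \<Longrightarrow> of_int c * F \<in> expsums p"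
proof (induction rule: expsums.induct)
  case (add F a c')
  then have "of_int c * F + of_int (c * c') * tpow_fps p a \<in> expsums p" by (blast intro: expsums.add)
  then show ?case by (simp add: algebra_simps)
qed (simp add: expsums.zero)

lemma expsums_tpow_fps_mult:
  assumes "F \<in> expsums p" "b \<in> padic p"
  shows "F * tpow_fps p b \<in> expsums p"
  using assms(1)
proof (induction rule: expsums.induct)
  case (add F a c)
  from expsums.add[OF add.IH padd_padic[OF add.hyps(2) assms(2)], of c]
  have "F * tpow_fps p b + of_int c * tpow_fps p (padd p a b) \<in> expsums p" .
  then show ?case
  proof (rule expsums_cong)
    have "(of_int p :: int fps) dvd of_int (- c) * (tpow_fps p (padd p a b) - tpow_fps p a * tpow_fps p b)"
      using tpow_fps_padd[OF add.hyps(2) assms(2)] by (rule dvd_mult)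
    moreover have "of_int (- c) * (tpow_fps p (padd p a b) - tpow_fps p a * tpow_fps p b) =
        (F + of_int c * tpow_fps p a) * tpow_fps p b - (F * tpow_fps p b + of_int c * tpow_fps p (padd p a b))"
      by (simp add: algebra_simps)
    ultimately show "(of_int p :: int fps) dvd (F + of_int c * tpow_fps p a) * tpow_fps p b - (F * tpow_fps p b + of_int c * tpow_fps p (padd p a b))"
      by metis
  qed
qed (simp add: expsums.zero)

lemma expsums_mult:
  assumes "F \<in> expsums p" "G \<in> expsums p"
  shows "F * G \<in> expsums p"
  using assms(2)
proof (induction rule: expsums.induct)
  case (add G a c)
  then have "F * G + of_int c * (F * tpow_fps p a) \<in> expsums p"
    using assms(1) expsums_add expsums_tpow_fps_mult expsums_of_int_mult by blast
  then show ?case by (simp add: algebra_simps)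
qed (simp add: expsums.zero)

lemma expsums_diff: "F \<in> expsums p \<Longrightarrow> G \<in> expsums p \<Longrightarrow> F - G \<in> expsums p"
  using expsums_add[of F "-G"] expsums_of_int_mult[of G "-1"] by simp

lemma expsums_prod: "finite A \<Longrightarrow> (\<And>i. i \<in> A \<Longrightarrow> F i \<in> expsums p) \<Longrightarrow> prod F A \<in> expsums p"
  by (induction A rule: finite_induct) (auto intro: one_expsums expsums_mult)

text \<open>Merging equal exponents makes the exponents in \<open>A\<close> distinct, which is what
  allows coefficients to be compared later.\<close>

lemma expsums_normal_form:
  "F \<in> expsums p \<Longrightarrow> \<exists>A c. finite A \<and> A \<subseteq> padic p \<and> (of_int p :: int fps) dvd F - (\<Sum>a\<in>A. of_int (c a) * tpow_fps p a)"
proof (induction rule: expsums.induct)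
  case (zero F)
  then show ?case by (intro exI[of _ "{}"]) auto
next
  case (add F a c)
  from add.IH obtain A d where A: "finite A" "A \<subseteq> padic p"
    "(of_int p :: int fps) dvd F - (\<Sum>a\<in>A. of_int (d a) * tpow_fps p a)" by blast
  define d' where "d' b = (if b \<in> A then d b else 0) + (if b = a then c else 0)" for b
  have "(\<Sum>b\<in>insert a A. of_int (d' b) * tpow_fps p b) =
      (\<Sum>b\<in>insert a A. (if b \<in> A then of_int (d b) * tpow_fps p b else 0)) +
      (\<Sum>b\<in>insert a A. (if b = a then of_int c * tpow_fps p b else 0))"
    unfolding sum.distrib[symmetric] by (rule sum.cong) (auto simp: d'_def algebra_simps)
  also have "(\<Sum>b\<in>insert a A. (if b \<in> A then of_int (d b) * tpow_fps p b else 0)) = (\<Sum>b\<in>A. of_int (d b) * tpow_fps p b)"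
    using A(1) by (intro sum.mono_neutral_cong_right) auto
  also have "(\<Sum>b\<in>insert a A. (if b = a then of_int c * tpow_fps p b else 0)) = of_int c * tpow_fps p a"
    using A(1) by (simp add: sum.delta)
  finally show ?case
    using A add.hyps(2) by (intro exI[of _ "insert a A"] exI[of _ d']) auto
qed

lemma sum_one_minus_X_collect:
  assumes "finite I" "\<And>i. i \<in> I \<Longrightarrow> e i < n"
  shows "(\<Sum>i\<in>I. of_int (c i) * (1 - fps_X) ^ e i) =
         (\<Sum>k<n. of_int (\<Sum>i\<in>I. if e i = k then c i else 0) * (1 - fps_X :: int fps) ^ k)"
proof -
  have "(\<Sum>k<n. of_int (\<Sum>i\<in>I. if e i = k then c i else 0) * (1 - fps_X :: int fps) ^ k) =
        (\<Sum>k<n. \<Sum>i\<in>I. if e i = k then of_int (c i) * (1 - fps_X :: int fps) ^ k else 0)"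
    by (simp add: sum_distrib_right of_int_sum) (intro sum.cong, auto)
  also have "\<dots> = (\<Sum>i\<in>I. \<Sum>k<n. if e i = k then of_int (c i) * (1 - fps_X :: int fps) ^ k else 0)"
    by (rule sum.swap)
  also have "\<dots> = (\<Sum>i\<in>I. of_int (c i) * (1 - fps_X) ^ e i)"
    using assms(2) by (intro sum.cong) auto
  finally show ?thesis by simp
qed

lemma one_minus_X_sum_independent:
  assumes "finite I" "\<And>i. i \<in> I \<Longrightarrow> e i < n"
    and "vanish p n (\<Sum>i\<in>I. of_int (c i) * (1 - fps_X) ^ e i)" and "k < n"
  shows "p dvd (\<Sum>i\<in>I. if e i = k then c i else 0)"
proof -
  have "vanish p n (\<Sum>k<n. of_int (\<Sum>i\<in>I. if e i = k then c i else 0) * (1 - fps_X) ^ k)"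
    using assms(3) sum_one_minus_X_collect[of I e n c] assms(1,2) by simp
  then show ?thesis using one_minus_X_powers_independent[of n "\<lambda>k. \<Sum>i\<in>I. if e i = k then c i else 0"] assms(4) by blast
qed

lemma tpow_fps_inj:
  assumes a: "a \<in> padic p" and b: "b \<in> padic p" and e: "(of_int p :: int fps) dvd tpow_fps p a - tpow_fps p b"
  shows "a = b"
proof (rule ccontr)
  assume "a \<noteq> b"
  then obtain n where n: "a n \<noteq> b n" by blast
  \<comment> \<open>The difference of two powers is written as a sum over booleans to fit
    \<open>one_minus_X_sum_independent\<close>; at level \<open>n\<close> the two exponents
    differ.\<close>
  define c :: "bool \<Rightarrow> int" where "c i = (if i then 1 else -1)" for i
  define f where "f i = nat ((if i then a else b) n)" for i
  have "vanish p (nat p ^ n) ((1 - fps_X) ^ nat (a n) - (1 - fps_X) ^ nat (b n))"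
    using vanish_sym[OF tpow_fps_approx[OF a, of n]] tpow_fps_approx[OF b, of n] vanish_dvd[OF e] vanish_trans by blast
  then have "vanish p (nat p ^ n) (\<Sum>i\<in>UNIV. of_int (c i) * (1 - fps_X) ^ f i)"
    by (simp add: UNIV_bool c_def f_def)
  then have "p dvd (\<Sum>i\<in>UNIV. if f i = nat (a n) then c i else 0)"
    by (rule one_minus_X_sum_independent[rotated 2])
      (use padic_less[OF a] padic_less[OF b] in \<open>auto simp: f_def\<close>)
  moreover have "nat (a n) \<noteq> nat (b n)" using n padic_nonneg[OF a, of n] padic_nonneg[OF b, of n] by simp
  ultimately have "p dvd 1" by (simp add: UNIV_bool c_def f_def split: if_splits)
  then show False using p by (metis not_prime_unit)
qed

text \<open>Monomials \<open>x^(p^k)\<close> with \<open>k >= N\<close> lie beyond the truncation,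
  and Frobenius rewrites each remaining one as \<open>1 - y^(p^k)\<close>.\<close>

lemma lacunary_approx:
  "vanish p (nat p ^ N) (lacunary p - (\<Sum>k<N. 1 - (1 - fps_X) ^ (nat p ^ k)))"
proof -
  have q: "Suc 0 < nat p" using p_gt_1 by simp
  have "vanish p (nat p ^ N) (lacunary p - (\<Sum>k<N. fps_X ^ (nat p ^ k)))"
    unfolding vanish_def
  proof (intro allI impI)
    fix i assume i: "i < nat p ^ N"
    have "(\<Sum>k<N. (fps_X ^ (nat p ^ k) :: int fps) $ i) = (\<Sum>k<N. if i = nat p ^ k then 1 else 0)"
      by simp
    also have "\<dots> = lacunary p $ i"
    proof (cases "\<exists>j. i = nat p ^ j")
      case True
      then obtain j where j: "i = nat p ^ j" by blast
      then have "j < N" using i q by simp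
      have "(\<Sum>k<N. if i = nat p ^ k then 1 else 0) = (\<Sum>k<N. if j = k then 1 else 0 :: int)"
        using q by (intro sum.cong) (auto simp: j)
      then show ?thesis using True \<open>j < N\<close> by (simp add: lacunary_def)
    qed (auto simp: lacunary_def)
    finally show "p dvd (lacunary p - (\<Sum>k<N. fps_X ^ (nat p ^ k))) $ i"
      by (simp add: fps_sum_nth)
  qed
  moreover have "vanish p (nat p ^ N) ((\<Sum>k<N. fps_X ^ (nat p ^ k)) - (\<Sum>k<N. 1 - (1 - fps_X) ^ (nat p ^ k)))"
    unfolding sum_subtractf[symmetric]
  proof (rule vanish_sum)
    fix k
    show "vanish p (nat p ^ N) (fps_X ^ (nat p ^ k) - (1 - (1 - fps_X) ^ (nat p ^ k)))"
      using vanish_dvd[OF frobenius_one_minus_X[of k]] by (simp add: algebra_simps)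
  qed
  ultimately show ?thesis by (rule vanish_trans)
qed

lemma expsum_approx:
  assumes "A \<subseteq> padic p" "(of_int p :: int fps) dvd F - (\<Sum>a\<in>A. of_int (c a) * tpow_fps p a)"
  shows "vanish p (nat p ^ N) (F - (\<Sum>a\<in>A. of_int (c a) * (1 - fps_X) ^ nat (a N)))"
  using vanish_dvd[OF assms(2)]
proof (rule vanish_trans)
  show "vanish p (nat p ^ N) ((\<Sum>a\<in>A. of_int (c a) * tpow_fps p a) - (\<Sum>a\<in>A. of_int (c a) * (1 - fps_X) ^ nat (a N)))"
    unfolding sum_subtractf[symmetric] right_diff_distrib[symmetric]
    by (intro vanish_sum vanish_mult tpow_fps_approx) (use assms(1) in auto)
qed

lemma nat_mod_add_cancel:
  fixes x u v n :: nat
  assumes "(x + u) mod n = (x + v) mod n" "u < n" "v < n"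
  shows "u = v"
proof -
  have "(int x + int u) mod int n = (int x + int v) mod int n"
    using assms(1) by (metis of_nat_add of_nat_mod)
  then have "int u mod int n = int v mod int n"
    by (simp add: mod_eq_dvd_iff)
  then show ?thesis using assms(2,3) by (simp flip: of_nat_mod)
qed

text \<open>A counting argument. If \<open>r\<close> were nonzero modulo \<open>p\<close>, then at
  level \<open>N\<close> the expansion of \<open>r * lacunary p\<close> would have terms
  \<open>y^(a0 + p^k)\<close> with the same nonzero coefficient for a number of \<open>k\<close>
  growing with \<open>N\<close>, while the other terms and \<open>s\<close> reach only a bounded
  number of these exponents.\<close>

lemma lacunary_not_quotient:
  assumes r: "r \<in> expsums p" and s: "s \<in> expsums p" and rs: "(of_int p :: int fps) dvd r * lacunary p - s"
  shows "(of_int p :: int fps) dvd r"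
proof (rule ccontr)
  assume nr: "\<not> (of_int p :: int fps) dvd r"
  define P where "P = nat p"
  have P1: "Suc 0 < P" using p_gt_1 by (simp add: P_def)
  let ?y = "1 - fps_X :: int fps"
  obtain A c where A: "finite A" "A \<subseteq> padic p" "(of_int p :: int fps) dvd r - (\<Sum>a\<in>A. of_int (c a) * tpow_fps p a)"
    using expsums_normal_form[OF r] by blast
  obtain B d where B: "finite B" "B \<subseteq> padic p" "(of_int p :: int fps) dvd s - (\<Sum>a\<in>B. of_int (d a) * tpow_fps p a)"
    using expsums_normal_form[OF s] by blast
  have "\<exists>a0\<in>A. \<not> p dvd c a0"
  proof (rule ccontr)
    assume "\<not> ?thesis"
    then have "(of_int p :: int fps) dvd (\<Sum>a\<in>A. of_int (c a) * tpow_fps p a)"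
      by (auto intro!: dvd_sum dvd_mult2) (metis dvd_def of_int_mult)
    from dvd_add[OF A(3) this] nr show False by simp
  qed
  then obtain a0 where a0: "a0 \<in> A" "\<not> p dvd c a0" by blast
  \<comment> \<open>At level \<open>N0\<close> the residue of \<open>a0\<close> already differs from
    that of every other exponent in \<open>A\<close>; the sum of the individual levels is a common
    upper bound.\<close>
  have "\<exists>N0. \<forall>a\<in>A. a \<noteq> a0 \<longrightarrow> a N0 \<noteq> a0 N0"
  proof -
    have "\<forall>a\<in>A. \<exists>n. a \<noteq> a0 \<longrightarrow> a n \<noteq> a0 n" by blast
    then obtain f where f: "\<And>a. a \<in> A \<Longrightarrow> a \<noteq> a0 \<Longrightarrow> a (f a) \<noteq> a0 (f a)" by metis
    define N0 where "N0 = (\<Sum>a\<in>A. f a)"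
    have "a N0 \<noteq> a0 N0" if "a \<in> A" "a \<noteq> a0" for a
    proof
      assume e: "a N0 = a0 N0"
      have "f a \<le> N0" unfolding N0_def using that(1) A(1) by (simp add: member_le_sum)
      then have "a (f a) = a0 (f a)"
        using padic_mod[of a "f a" N0] padic_mod[of a0 "f a" N0] subsetD[OF A(2)] that(1) a0(1) e by simp
      then show False using f that by blast
    qed
    then show ?thesis by blast
  qed
  then obtain N0 where N0: "\<And>a. a \<in> A \<Longrightarrow> a \<noteq> a0 \<Longrightarrow> a N0 \<noteq> a0 N0" by blast
  \<comment> \<open>Chosen so that the candidates \<open>k\<close> in \<open>{N0..<N}\<close>
    outnumber the exponents in \<open>bad\<close>, whose count is bounded independently of
    \<open>N\<close>.\<close>
  define N where "N = N0 + (card A + card B + card A * N0 + 1)"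
  define e where "e = (\<lambda>(a :: nat \<Rightarrow> int, k). (nat (a N) + P ^ k) mod P ^ N)"
  have PN: "0 < P ^ N" using P1 by simp
  have eN: "e x < P ^ N" for x using PN by (cases x) (simp add: e_def)
  have aN: "nat (a N) < P ^ N" if "a \<in> A \<union> B" for a
    using padic_less[of a N] that A(2) B(2) by (auto simp: P_def)
  \<comment> \<open>Modulo \<open>P ^ N0\<close> the summand \<open>P ^ l\<close> with
    \<open>l >= N0\<close> disappears, so the exponent determines the residue of \<open>a\<close> at
    level \<open>N0\<close>, whence \<open>a = a0\<close>; cancelling then recovers
    \<open>k\<close>.\<close>
  have e_inj: "a = a0 \<and> j = k" if "a \<in> A" "j \<in> {N0..<N}" "k \<in> {N0..<N}" "e (a, j) = e (a0, k)" for a j k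
  proof -
    have red: "e (b, l) mod P ^ N0 = nat (b N0)" if "b \<in> A" "l \<in> {N0..<N}" for b l
    proof -
      have "e (b, l) mod P ^ N0 = (nat (b N) + P ^ l) mod P ^ N0"
        using that(2) by (simp add: e_def mod_mod_cancel le_imp_power_dvd)
      also have "\<dots> = nat (b N) mod P ^ N0"
        using that(2) by (metis atLeastLessThan_iff le_imp_power_dvd mod_add_right_eq dvd_imp_mod_0 add_0_right)
      finally show ?thesis using nat_padic_mod[of b N0 N] that A(2) by (auto simp: P_def N_def)
    qed
    have "nat (a N0) = nat (a0 N0)" using red[of a j] red[of a0 k] that a0 by simp
    then have "a N0 = a0 N0" using padic_nonneg[of a N0] padic_nonneg[of a0 N0] subsetD[OF A(2)] that(1) a0(1) by simp
    then have aa: "a = a0" using N0 that(1) by blast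
    have "P ^ j < P ^ N" "P ^ k < P ^ N" using that P1 by simp_all
    then have "P ^ j = P ^ k" using that(4) unfolding aa e_def by (auto dest: nat_mod_add_cancel)
    then show ?thesis using aa P1 by simp
  qed
  \<comment> \<open>The exponents at which a term other than \<open>c a0 * y ^ e (a0, k)\<close>, \<open>k \<ge> N0\<close>, may contribute.\<close>
  define bad where "bad = (\<lambda>a. nat (a N)) ` A \<union> (\<lambda>a. nat (a N)) ` B \<union> e ` (A \<times> {..<N0})"
  have "finite bad" using A B by (simp add: bad_def)
  have "card bad \<le> card A + card B + card A * N0"
    unfolding bad_def
    by (intro card_Un_le[THEN order_trans] add_mono card_image_le[THEN order_trans])
      (use A B in \<open>simp_all add: card_cartesian_product\<close>)
  also have "\<dots> < card {N0..<N}" by (simp add: N_def)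
  also have "\<dots> = card ((\<lambda>k. e (a0, k)) ` {N0..<N})"
    by (rule card_image[symmetric]) (use e_inj a0 in \<open>auto simp: inj_on_def\<close>)
  finally have "\<not> (\<lambda>k. e (a0, k)) ` {N0..<N} \<subseteq> bad"
    using card_mono[OF \<open>finite bad\<close>] by (meson not_less)
  then obtain k0 where k0: "k0 \<in> {N0..<N}" "e (a0, k0) \<notin> bad" by blast
  define i where "i = e (a0, k0)"
  \<comment> \<open>Coefficients of \<open>y^k\<close> in the three parts of the identity: the
    \<open>N\<close> constants 1 in the approximation of the lacunary series, whence
    \<open>int N\<close>; the terms \<open>y^(a + p^k)\<close>; and \<open>s\<close>.\<close>
  define w1 where "w1 k = (\<Sum>a\<in>A. if nat (a N) = k then int N * c a else 0)" for k
  define w2 where "w2 k = (\<Sum>x\<in>A \<times> {..<N}. if e x = k then c (fst x) else 0)" for k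
  define w3 where "w3 k = (\<Sum>a\<in>B. if nat (a N) = k then d a else 0)" for k
  let ?F = "\<Sum>a\<in>A. of_int (c a) * ?y ^ nat (a N)"
  have W1: "(\<Sum>k<P ^ N. of_int (w1 k) * ?y ^ k) = (\<Sum>a\<in>A. of_int (int N * c a) * ?y ^ nat (a N))"
    unfolding w1_def by (rule sum_one_minus_X_collect[symmetric]) (use A aN in auto)
  have W2: "(\<Sum>k<P ^ N. of_int (w2 k) * ?y ^ k) = (\<Sum>x\<in>A \<times> {..<N}. of_int (c (fst x)) * ?y ^ e x)"
    unfolding w2_def by (rule sum_one_minus_X_collect[symmetric]) (use A eN in auto)
  have W3: "(\<Sum>k<P ^ N. of_int (w3 k) * ?y ^ k) = (\<Sum>a\<in>B. of_int (d a) * ?y ^ nat (a N))"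
    unfolding w3_def by (rule sum_one_minus_X_collect[symmetric]) (use B aN in auto)
  have "vanish p (P ^ N) (r * lacunary p - ?F * (\<Sum>k<N. 1 - ?y ^ (P ^ k)))"
    unfolding P_def by (rule vanish_cong_mult[OF expsum_approx[OF A(2,3)] lacunary_approx])
  from vanish_trans[OF vanish_sym[OF this] vanish_dvd[OF rs]]
  have "vanish p (P ^ N) (?F * (\<Sum>k<N. 1 - ?y ^ (P ^ k)) - s)" .
  from vanish_trans[OF this expsum_approx[OF B(2,3), of N, folded P_def]]
  have v: "vanish p (P ^ N) (?F * (\<Sum>k<N. 1 - ?y ^ (P ^ k)) - (\<Sum>a\<in>B. of_int (d a) * ?y ^ nat (a N)))" .
  have FS: "?F * (\<Sum>k<N. 1 - ?y ^ (P ^ k)) =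
      (\<Sum>a\<in>A. of_int (int N * c a) * ?y ^ nat (a N)) - (\<Sum>x\<in>A \<times> {..<N}. of_int (c (fst x)) * ?y ^ (nat (fst x N) + P ^ snd x))"
    by (simp add: sum_subtractf right_diff_distrib sum_product sum.cartesian_product case_prod_unfold power_add sum_distrib_left sum_distrib_right algebra_simps)
  have "vanish p (P ^ N) ((\<Sum>x\<in>A \<times> {..<N}. of_int (c (fst x)) * ?y ^ (nat (fst x N) + P ^ snd x)) -
      (\<Sum>x\<in>A \<times> {..<N}. of_int (c (fst x)) * ?y ^ e x))"
    unfolding sum_subtractf[symmetric] right_diff_distrib[symmetric] P_def
    by (intro vanish_sum vanish_mult vanish_one_minus_X_cong) (auto simp: e_def P_def)
  from v[unfolded FS] this have "vanish p (P ^ N) (\<Sum>k<P ^ N. of_int (w1 k - w2 k - w3 k) * ?y ^ k)"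
    unfolding of_int_diff left_diff_distrib sum_subtractf W1 W2 W3
    by (rule vanish_replace)
  from one_minus_X_powers_independent[OF this, of i]
  have "p dvd w1 i - w2 i - w3 i" using eN by (simp add: i_def)
  moreover have ne: "nat (a N) \<noteq> i" if "a \<in> A \<union> B" for a
  proof
    assume "nat (a N) = i"
    moreover have "nat (a N) \<in> bad" using that unfolding bad_def by blast
    ultimately show False using k0(2) by (simp add: i_def)
  qed
  moreover have "w1 i = 0" unfolding w1_def by (rule sum.neutral) (use ne in simp)
  moreover have "w3 i = 0" unfolding w3_def by (rule sum.neutral) (use ne in simp)
  \<comment> \<open>Terms with second index below \<open>N0\<close> are excluded by
    \<open>bad\<close>, all others except \<open>(a0, k0)\<close> by \<open>e_inj\<close>.\<close>
  moreover have "w2 i = (\<Sum>x\<in>A \<times> {..<N}. if x = (a0, k0) then c (fst x) else 0)"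
    unfolding w2_def
  proof (rule sum.cong)
    fix x assume x: "x \<in> A \<times> {..<N}"
    have "e x = i \<longleftrightarrow> x = (a0, k0)"
    proof
      assume ex: "e x = i"
      have "snd x \<ge> N0"
      proof (rule ccontr)
        assume "\<not> snd x \<ge> N0"
        then have "e x \<in> bad" using x unfolding bad_def by (cases x) auto
        then show False using ex k0 by (simp add: i_def)
      qed
      then show "x = (a0, k0)" using e_inj[of "fst x" "snd x" k0] x k0 ex by (cases x) (auto simp: i_def)
    qed (simp add: i_def)
    then show "(if e x = i then c (fst x) else 0) = (if x = (a0, k0) then c (fst x) else 0)" by simp
  qed simp
  moreover have "\<dots> = c a0" using A a0 k0 by simp
  ultimately show False using a0(2) by simp
qed

end

section \<open>A discontinuous linear map\<close>

definition expsum_submodule :: "int \<Rightarrow> int fps set \<Rightarrow> bool" where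
  "expsum_submodule p H \<longleftrightarrow> (\<forall>F. (of_int p :: int fps) dvd F \<longrightarrow> F \<in> H) \<and>
     (\<forall>F\<in>H. \<forall>G\<in>H. F + G \<in> H) \<and> (\<forall>r\<in>expsums p. \<forall>F\<in>H. r * F \<in> H)"

text \<open>A linear map with values in the fraction field is replaced by its multiple \<open>T\<close> by a common
  denominator \<open>s\<close>; hence \<open>T\<close> exists only on a submodule \<open>D\<close>, which can be chosen to contain any
  given finite set.\<close>

definition expsum_linear :: "int \<Rightarrow> int fps set \<Rightarrow> (int fps \<Rightarrow> int fps) \<Rightarrow> bool" where
  "expsum_linear p D T \<longleftrightarrow>
     (\<forall>F\<in>D. \<forall>G\<in>D. F + G \<in> D \<and> (of_int p :: int fps) dvd T (F + G) - (T F + T G)) \<and>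
     (\<forall>a\<in>padic p. \<forall>F\<in>D. tpow_fps p a * F \<in> D \<and> (of_int p :: int fps) dvd T (tpow_fps p a * F) - tpow_fps p a * T F) \<and>
     (\<forall>F\<in>D. \<forall>G. (of_int p :: int fps) dvd G - F \<longrightarrow> G \<in> D \<and> (of_int p :: int fps) dvd T G - T F)"

context prime_modulus
begin

lemma expsum_submodule_expsums: "expsum_submodule p (expsums p)"
  unfolding expsum_submodule_def by (blast intro: expsums.zero expsums_add expsums_mult)

lemma expsum_submodule_span:
  assumes "expsum_submodule p H"
  shows "expsum_submodule p {F + r * g | F r. F \<in> H \<and> r \<in> expsums p}" (is "expsum_submodule p ?S")
  unfolding expsum_submodule_def
proof (intro conjI allI impI ballI)
  fix F assume "(of_int p :: int fps) dvd F"
  then have "F = F + 0 * g \<and> F \<in> H \<and> 0 \<in> expsums p"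
    using assms by (simp add: expsum_submodule_def expsums.zero)
  then show "F \<in> ?S" by blast
next
  fix F G assume "F \<in> ?S" "G \<in> ?S"
  then obtain F' r G' s where *: "F = F' + r * g" "F' \<in> H" "r \<in> expsums p" "G = G' + s * g" "G' \<in> H" "s \<in> expsums p"
    by blast
  then have "F + G = (F' + G') + (r + s) * g \<and> F' + G' \<in> H \<and> r + s \<in> expsums p"
    using assms by (simp add: expsum_submodule_def expsums_add algebra_simps)
  then show "F + G \<in> ?S" by blast
next
  fix r F assume r: "r \<in> expsums p" and "F \<in> ?S"
  then obtain F' s where *: "F = F' + s * g" "F' \<in> H" "s \<in> expsums p" by blast
  then have "r * F = r * F' + (r * s) * g \<and> r * F' \<in> H \<and> r * s \<in> expsums p"
    using assms r by (simp add: expsum_submodule_def expsums_mult distrib_left mult.assoc)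
  then show "r * F \<in> ?S" by blast
qed

text \<open>Zorn's lemma for the submodules that contain 1 and meet the multiples of
  \<open>lacunary p\<close> trivially. Since a maximal one cannot be enlarged, every series becomes,
  up to a denominator, a multiple of \<open>lacunary p\<close> modulo \<open>H\<close>.\<close>

lemma maximal_submodule_avoiding_lacunary:
  "\<exists>H. expsum_submodule p H \<and> 1 \<in> H \<and>
    (\<forall>r\<in>expsums p. r * lacunary p \<in> H \<longrightarrow> (of_int p :: int fps) dvd r) \<and>
    (\<forall>g. \<exists>s\<in>expsums p. \<not> (of_int p :: int fps) dvd s \<and> (\<exists>r\<in>expsums p. s * g - r * lacunary p \<in> H))"
proof -
  define A where "A = {H. expsum_submodule p H \<and> 1 \<in> H \<and>
    (\<forall>r\<in>expsums p. r * lacunary p \<in> H \<longrightarrow> (of_int p :: int fps) dvd r)}"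
  \<comment> \<open>The family is nonempty because it contains \<open>R\<close>: here
    \<open>s\<close> is taken to be \<open>r * lacunary p\<close> itself.\<close>
  have "(of_int p :: int fps) dvd r" if "r \<in> expsums p" "r * lacunary p \<in> expsums p" for r
    by (rule lacunary_not_quotient[OF that]) simp
  then have "expsums p \<in> A"
    unfolding A_def using expsum_submodule_expsums one_expsums by simp
  have "\<exists>M\<in>A. \<forall>X\<in>A. M \<subseteq> X \<longrightarrow> X = M"
  proof (rule subset_Zorn_nonempty)
    show "A \<noteq> {}" using \<open>expsums p \<in> A\<close> by blast
  next
    fix C assume C: "C \<noteq> {}" "subset.chain A C"
    have CA: "C \<subseteq> A" using C by (simp add: subset.chain_def)
    have pair: "\<exists>X\<in>C. F \<in> X \<and> G \<in> X" if "F \<in> \<Union>C" "G \<in> \<Union>C" for F G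
    proof -
      obtain X1 X2 where X: "X1 \<in> C" "F \<in> X1" "X2 \<in> C" "G \<in> X2" using \<open>F \<in> \<Union>C\<close> \<open>G \<in> \<Union>C\<close> by blast
      then have "X1 \<subseteq> X2 \<or> X2 \<subseteq> X1" using C(2) by (auto simp: subset_chain_def)
      then show ?thesis using X by blast
    qed
    have mem: "expsum_submodule p X" "1 \<in> X"
      "\<And>r. r \<in> expsums p \<Longrightarrow> r * lacunary p \<in> X \<Longrightarrow> (of_int p :: int fps) dvd r" if "X \<in> C" for X
      using CA that unfolding A_def by auto
    have "F + G \<in> \<Union>C" if FG: "F \<in> \<Union>C" "G \<in> \<Union>C" for F G
    proof -
      obtain X where X: "X \<in> C" "F \<in> X" "G \<in> X" using pair[OF FG] by blast
      then have "F + G \<in> X" using mem(1) by (simp add: expsum_submodule_def)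
      then show ?thesis using X(1) by blast
    qed
    moreover have "r * F \<in> \<Union>C" if rF: "F \<in> \<Union>C" "r \<in> expsums p" for F r
    proof -
      obtain X where X: "X \<in> C" "F \<in> X" using rF(1) by blast
      then have "r * F \<in> X" using mem(1) rF(2) by (simp add: expsum_submodule_def)
      then show ?thesis using X(1) by blast
    qed
    moreover obtain X where X: "X \<in> C" using C(1) by blast
    moreover have "F \<in> X" if "(of_int p :: int fps) dvd F" for F
      using that mem(1)[OF X] by (simp add: expsum_submodule_def)
    moreover have "1 \<in> X" using mem(2)[OF X] .
    moreover have "(of_int p :: int fps) dvd r" if "r \<in> expsums p" "r * lacunary p \<in> \<Union>C" for r
      using that mem(3) by blast
    ultimately show "\<Union>C \<in> A" unfolding A_def expsum_submodule_def by blast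
  qed
  then obtain H where H: "H \<in> A" "\<And>X. X \<in> A \<Longrightarrow> H \<subseteq> X \<Longrightarrow> X = H" by metis
  have sub: "expsum_submodule p H" and "1 \<in> H"
    and avoid: "\<And>r. r \<in> expsums p \<Longrightarrow> r * lacunary p \<in> H \<Longrightarrow> (of_int p :: int fps) dvd r"
    using H(1) unfolding A_def by simp_all
  have z: "0 \<in> expsums p" by (simp add: expsums.zero)
  have "\<exists>s\<in>expsums p. \<not> (of_int p :: int fps) dvd s \<and> (\<exists>r\<in>expsums p. s * g - r * lacunary p \<in> H)" for g
  proof (cases "g \<in> H")
    case True
    have "\<not> (of_int p :: int fps) dvd 1"
      using p by (auto simp: of_int_dvd_fps_iff not_prime_unit intro!: exI[of _ 0])
    then show ?thesis using True one_expsums z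
      by (intro bexI[of _ 1] conjI bexI[of _ 0]) auto
  next
    case False
    \<comment> \<open>\<open>H + R g\<close> is strictly larger than \<open>H\<close>, so by
      maximality it contains a nonzero multiple of \<open>lacunary p\<close>; this multiple yields
      the relation for \<open>g\<close>.\<close>
    define S where "S = {F + r * g | F r. F \<in> H \<and> r \<in> expsums p}"
    have "H \<subseteq> S"
    proof
      fix F assume "F \<in> H"
      then have "F = F + 0 * g \<and> F \<in> H \<and> 0 \<in> expsums p" using z by simp
      then show "F \<in> S" unfolding S_def by blast
    qed
    have "(0 :: int fps) \<in> H" using sub by (simp add: expsum_submodule_def)
    then have "0 + 1 * g \<in> S" unfolding S_def using one_expsums by blast
    then have "S \<noteq> H" using False by auto
    then have "S \<notin> A" using H(2) \<open>H \<subseteq> S\<close> by blast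
    moreover have "expsum_submodule p S" unfolding S_def by (rule expsum_submodule_span[OF sub])
    moreover have "1 \<in> S" using \<open>H \<subseteq> S\<close> \<open>1 \<in> H\<close> by blast
    ultimately obtain r where r: "r \<in> expsums p" "r * lacunary p \<in> S" "\<not> (of_int p :: int fps) dvd r"
      by (auto simp: A_def)
    then obtain F s where Fs: "r * lacunary p = F + s * g" "F \<in> H" "s \<in> expsums p" unfolding S_def by blast
    have neg: "- F \<in> H"
    proof -
      have "-1 \<in> expsums p" using expsums_diff[OF z one_expsums] by simp
      then have "-1 * F \<in> H" using sub Fs(2) unfolding expsum_submodule_def by blast
      then show ?thesis by simp
    qed
    have "\<not> (of_int p :: int fps) dvd s"
    proof
      assume "(of_int p :: int fps) dvd s"
      then have "s * g \<in> H" using sub by (simp add: expsum_submodule_def)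
      then have "r * lacunary p \<in> H" using Fs sub unfolding expsum_submodule_def by simp
      then show False using avoid r by blast
    qed
    moreover have "s * g - r * lacunary p \<in> H" using neg Fs(1) by simp
    ultimately show ?thesis using Fs(3) r(1) by blast
  qed
  with sub \<open>1 \<in> H\<close> avoid show ?thesis by (intro exI[of _ H]) simp
qed

text \<open>The map is determined by \<open>s * g = T g * lacunary p\<close> modulo
  \<open>H\<close>, where \<open>s\<close> is a common denominator for \<open>X\<close>. By
  linearity it kills all polynomials in \<open>y\<close>, which are dense, but not the lacunary
  series, so it cannot be continuous.\<close>

lemma discontinuous_linear_map:
  assumes "finite X"
  shows "\<exists>D T s. X \<subseteq> D \<and> \<not> (of_int p :: int fps) dvd s \<and> expsum_linear p D T \<and>
    1 \<in> D \<and> (of_int p :: int fps) dvd T 1 \<and>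
    (\<forall>a\<in>padic p. tpow_fps p a * lacunary p \<in> D \<and> (of_int p :: int fps) dvd T (tpow_fps p a * lacunary p) - s * tpow_fps p a)"
proof -
  obtain H where sub: "expsum_submodule p H" and one: "1 \<in> H"
    and avoid: "\<And>r. r \<in> expsums p \<Longrightarrow> r * lacunary p \<in> H \<Longrightarrow> (of_int p :: int fps) dvd r"
    and ex: "\<And>g. \<exists>s\<in>expsums p. \<not> (of_int p :: int fps) dvd s \<and> (\<exists>r\<in>expsums p. s * g - r * lacunary p \<in> H)"
    using maximal_submodule_avoiding_lacunary by auto
  have Hp: "\<And>F. (of_int p :: int fps) dvd F \<Longrightarrow> F \<in> H" and Hadd: "\<And>F G. F \<in> H \<Longrightarrow> G \<in> H \<Longrightarrow> F + G \<in> H"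
    and Hmult: "\<And>r F. r \<in> expsums p \<Longrightarrow> F \<in> H \<Longrightarrow> r * F \<in> H"
    using sub unfolding expsum_submodule_def by blast+
  have z: "0 \<in> expsums p" by (simp add: expsums.zero)
  have m1: "-1 \<in> expsums p" using expsums_diff[OF z one_expsums] by simp
  have Hdiff: "F - G \<in> H" if "F \<in> H" "G \<in> H" for F G
    using Hadd[OF that(1) Hmult[OF m1 that(2)]] by simp
  from ex obtain \<sigma> where \<sigma>: "\<And>g. \<sigma> g \<in> expsums p" "\<And>g. \<not> (of_int p :: int fps) dvd \<sigma> g"
    "\<And>g. \<exists>r\<in>expsums p. \<sigma> g * g - r * lacunary p \<in> H" by metis
  define s where "s = prod \<sigma> X"
  have s: "s \<in> expsums p" unfolding s_def using assms \<sigma>(1) by (rule expsums_prod)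
  have s': "\<not> (of_int p :: int fps) dvd s"
    unfolding s_def using assms
  proof (induction X rule: finite_induct)
    case empty
    then show ?case using p by (auto simp: of_int_dvd_fps_iff not_prime_unit intro!: exI[of _ 0])
  next
    case (insert x X)
    then show ?case using prime_dvd_fps_mult \<sigma>(2) by auto
  qed
  define D where "D = {g. \<exists>r\<in>expsums p. s * g - r * lacunary p \<in> H}"
  define T where "T g = (SOME r. r \<in> expsums p \<and> s * g - r * lacunary p \<in> H)" for g
  have T: "T g \<in> expsums p \<and> s * g - T g * lacunary p \<in> H" if "g \<in> D" for g
    using that unfolding D_def T_def by (auto intro: someI2_ex)
  \<comment> \<open>The difference of two admissible values multiplies \<open>lacunary p\<close>
    into \<open>H\<close> and is therefore 0 modulo \<open>p\<close>. Each congruence for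
    \<open>T\<close> below is proved by exhibiting an admissible value.\<close>
  have unique: "(of_int p :: int fps) dvd T g - r" if "s * g - r * lacunary p \<in> H" "r \<in> expsums p" for g r
  proof -
    have "g \<in> D" using that by (auto simp: D_def)
    have "(s * g - r * lacunary p) - (s * g - T g * lacunary p) \<in> H"
      using Hdiff that T[OF \<open>g \<in> D\<close>] by blast
    then have "(T g - r) * lacunary p \<in> H" by (simp add: algebra_simps)
    then show ?thesis using avoid expsums_diff T[OF \<open>g \<in> D\<close>] that by blast
  qed
  have DI: "g \<in> D" if "s * g - r * lacunary p \<in> H" "r \<in> expsums p" for g r
    using that by (auto simp: D_def)
  have add: "s * (F + G) - (T F + T G) * lacunary p \<in> H \<and> T F + T G \<in> expsums p" if "F \<in> D" "G \<in> D" for F G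
    using Hadd[of "s * F - T F * lacunary p" "s * G - T G * lacunary p"] T[OF that(1)] T[OF that(2)]
    by (simp add: algebra_simps expsums_add)
  have mult: "s * (tpow_fps p a * F) - (tpow_fps p a * T F) * lacunary p \<in> H \<and> tpow_fps p a * T F \<in> expsums p"
    if "a \<in> padic p" "F \<in> D" for a F
    using Hmult[OF tpow_fps_expsums[OF that(1)], of "s * F - T F * lacunary p"] T[OF that(2)]
      expsums_mult[OF tpow_fps_expsums[OF that(1)]]
    by (simp add: algebra_simps)
  have cong: "s * G - T F * lacunary p \<in> H \<and> T F \<in> expsums p" if "F \<in> D" "(of_int p :: int fps) dvd G - F" for F G
  proof -
    have "s * (G - F) \<in> H" using that(2) by (intro Hp dvd_mult)
    then have "s * (G - F) + (s * F - T F * lacunary p) \<in> H" using T[OF that(1)] Hadd by blast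
    then show ?thesis using T[OF that(1)] by (simp add: algebra_simps)
  qed
  \<comment> \<open>As 1 lies in \<open>H\<close>, the value 0 is admissible at 1. For multiples of
    the lacunary series, next, the difference is literally 0.\<close>
  have one': "s * 1 - 0 * lacunary p \<in> H" using Hmult[OF s one] by simp
  have lacunary': "s * (tpow_fps p a * lacunary p) - (s * tpow_fps p a) * lacunary p \<in> H \<and> s * tpow_fps p a \<in> expsums p" if "a \<in> padic p" for a
    using Hp[of 0] expsums_mult[OF s tpow_fps_expsums[OF that]] by (simp add: algebra_simps)
  have "X \<subseteq> D"
  proof
    fix g assume "g \<in> X"
    then have s2: "s = prod \<sigma> (X - {g}) * \<sigma> g" unfolding s_def using assms by (simp add: prod.remove)
    have c: "prod \<sigma> (X - {g}) \<in> expsums p" using assms \<sigma>(1) by (intro expsums_prod) auto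
    obtain r where r: "r \<in> expsums p" "\<sigma> g * g - r * lacunary p \<in> H" using \<sigma>(3) by blast
    have "s * g - (prod \<sigma> (X - {g}) * r) * lacunary p \<in> H"
      using Hmult[OF c r(2)] by (simp add: s2 algebra_simps)
    then show "g \<in> D" using expsums_mult[OF c r(1)] by (rule DI)
  qed
  have "expsum_linear p D T"
    unfolding expsum_linear_def
  proof (intro conjI ballI allI impI)
    show "F + G \<in> D" "(of_int p :: int fps) dvd T (F + G) - (T F + T G)" if "F \<in> D" "G \<in> D" for F G
      using add[OF that] DI unique by blast+
    show "tpow_fps p a * F \<in> D" "(of_int p :: int fps) dvd T (tpow_fps p a * F) - tpow_fps p a * T F"
      if "a \<in> padic p" "F \<in> D" for a F
      using mult[OF that] DI unique by blast+
    show "G \<in> D" "(of_int p :: int fps) dvd T G - T F" if "F \<in> D" "(of_int p :: int fps) dvd G - F" for F G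
      using cong[OF that] DI unique by blast+
  qed
  moreover have "1 \<in> D" using DI[OF one' z] .
  moreover have "(of_int p :: int fps) dvd T 1" using unique[OF one' z] by simp
  moreover have "tpow_fps p a * lacunary p \<in> D \<and> (of_int p :: int fps) dvd T (tpow_fps p a * lacunary p) - s * tpow_fps p a"
    if "a \<in> padic p" for a
    using lacunary'[OF that] DI unique by blast
  ultimately show ?thesis using \<open>X \<subseteq> D\<close> s' by blast
qed

end

section \<open>Low-degree bar chains\<close>

definition single :: "'x \<Rightarrow> 'x \<Rightarrow> int" where
  "single q = (\<lambda>y. if q = y then 1 else 0)"

definition commutator_chain :: "'a \<Rightarrow> 'a \<Rightarrow> 'a \<times> 'a \<Rightarrow> int" where
  "commutator_chain a b = (\<lambda>q. single (a, b) q - single (b, a) q)"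

definition face3 :: "('a, 'b) monoid_scheme \<Rightarrow> 'a \<times> 'a \<times> 'a \<Rightarrow> 'a \<times> 'a \<Rightarrow> int" where
  "face3 G q y = (case q of (g, h, k) \<Rightarrow>
      single (h, k) y - single (g \<otimes>\<^bsub>G\<^esub> h, k) y + single (g, h \<otimes>\<^bsub>G\<^esub> k) y - single (g, h) y)"

lemma supp_single [simp]: "supp (single q) = {q}"
  by (auto simp: supp_def single_def)

lemma supp_zero [simp]: "supp (\<lambda>_. 0) = {}"
  by (simp add: supp_def)

lemma sum_supp_single: "(\<Sum>q\<in>supp (single x). single x q * f q) = f x"
  unfolding supp_single by (simp add: single_def)

lemma sum_supp_eq:
  assumes "finite S" "supp c \<subseteq> S"
  shows "(\<Sum>q\<in>supp c. c q * f q) = (\<Sum>q\<in>S. c q * f q)"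
  by (rule sum.mono_neutral_left) (use assms in \<open>auto simp: supp_def\<close>)

lemma d3_eq: "d3 G c y = (\<Sum>q\<in>supp c. c q * face3 G q y)"
  unfolding d3_def face3_def single_def by (simp add: case_prod_unfold)

lemma sum_supp_add:
  assumes "finite (supp c)" "finite (supp c')"
  shows "(\<Sum>q\<in>supp (\<lambda>q. c q + c' q). (c q + c' q) * f q) =
         (\<Sum>q\<in>supp c. c q * f q) + (\<Sum>q\<in>supp c'. c' q * f q)"
proof -
  let ?S = "supp c \<union> supp c'"
  have S: "finite ?S" using assms by simp
  have "supp (\<lambda>q. c q + c' q) \<subseteq> ?S" by (auto simp: supp_def)
  from sum_supp_eq[OF S this, of f] sum_supp_eq[OF S, of c f] sum_supp_eq[OF S, of c' f]
  show ?thesis by (simp add: sum.distrib distrib_right)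
qed

lemma sum_supp_mult:
  fixes c :: "'x \<Rightarrow> int"
  shows "(\<Sum>q\<in>supp (\<lambda>q. k * c q). (k * c q) * f q) = k * (\<Sum>q\<in>supp c. c q * f q)"
proof (cases "k = 0")
  case False
  then have "supp (\<lambda>q. k * c q) = supp c" by (auto simp: supp_def)
  then show ?thesis by (simp add: sum_distrib_left mult.assoc)
qed (simp add: supp_def)

lemma d3_add:
  assumes "c \<in> chains3 G" "c' \<in> chains3 G"
  shows "d3 G (\<lambda>q. c q + c' q) y = d3 G c y + d3 G c' y"
  unfolding d3_eq by (rule sum_supp_add) (use assms in \<open>auto simp: chains3_def\<close>)

lemma d3_mult: "d3 G (\<lambda>q. k * c q) y = k * d3 G c y"
  unfolding d3_eq by (rule sum_supp_mult)

lemma chains3_add: "c \<in> chains3 G \<Longrightarrow> c' \<in> chains3 G \<Longrightarrow> (\<lambda>q. c q + c' q) \<in> chains3 G"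
proof -
  assume *: "c \<in> chains3 G" "c' \<in> chains3 G"
  have "supp (\<lambda>q. c q + c' q) \<subseteq> supp c \<union> supp c'" by (auto simp: supp_def)
  with * show ?thesis unfolding chains3_def by (auto intro: finite_subset)
qed

lemma chains3_mult: "c \<in> chains3 G \<Longrightarrow> (\<lambda>q. k * c q) \<in> chains3 G"
proof -
  assume *: "c \<in> chains3 G"
  have "supp (\<lambda>q. k * c q) \<subseteq> supp c" by (auto simp: supp_def)
  with * show ?thesis unfolding chains3_def by (auto intro: finite_subset)
qed

lemma is_boundary2_add:
  assumes "is_boundary2 G p z" "is_boundary2 G p z'"
  shows "is_boundary2 G p (\<lambda>q. z q + z' q)"
proof -
  from assms obtain c c' where c: "c \<in> chains3 G" "\<And>y. p dvd z y - d3 G c y"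
    and c': "c' \<in> chains3 G" "\<And>y. p dvd z' y - d3 G c' y"
    unfolding is_boundary2_def by blast
  have "p dvd (z y + z' y) - d3 G (\<lambda>q. c q + c' q) y" for y
    using dvd_add[OF c(2)[of y] c'(2)[of y]] by (simp add: d3_add c c' algebra_simps)
  then show ?thesis unfolding is_boundary2_def using chains3_add[OF c(1) c'(1)] by blast
qed

lemma is_boundary2_mult:
  assumes "is_boundary2 G p z"
  shows "is_boundary2 G p (\<lambda>q. k * z q)"
proof -
  from assms obtain c where c: "c \<in> chains3 G" "\<And>y. p dvd z y - d3 G c y"
    unfolding is_boundary2_def by blast
  have "p dvd k * z y - d3 G (\<lambda>q. k * c q) y" for y
    using dvd_mult[OF c(2)[of y], of k] by (simp add: d3_mult right_diff_distrib)
  then show ?thesis unfolding is_boundary2_def using chains3_mult[OF c(1)] by blast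
qed

lemma is_boundary2_uminus: "is_boundary2 G p z \<Longrightarrow> is_boundary2 G p (\<lambda>q. - z q)"
  using is_boundary2_mult[of G p z "-1"] by simp

lemma is_boundary2_diff:
  "is_boundary2 G p z \<Longrightarrow> is_boundary2 G p z' \<Longrightarrow> is_boundary2 G p (\<lambda>q. z q - z' q)"
  using is_boundary2_add[OF _ is_boundary2_uminus, of G p z z'] by simp

lemma is_boundary2_dvd:
  assumes "\<And>y. p dvd z y"
  shows "is_boundary2 G p z"
proof -
  have "(\<lambda>_. 0) \<in> chains3 G" "d3 G (\<lambda>_. 0) y = 0" for y
    by (simp_all add: chains3_def d3_eq)
  then show ?thesis unfolding is_boundary2_def using assms by (intro bexI[of _ "\<lambda>_. 0"]) auto
qed

lemma is_boundary2_face3: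
  assumes "g \<in> carrier G" "h \<in> carrier G" "k \<in> carrier G"
  shows "is_boundary2 G p (face3 G (g, h, k))"
proof -
  have "single (g, h, k) \<in> chains3 G" using assms by (simp add: chains3_def)
  moreover have "d3 G (single (g, h, k)) y = face3 G (g, h, k) y" for y
    by (simp add: d3_eq) (simp add: single_def)
  ultimately show ?thesis unfolding is_boundary2_def by (intro bexI[of _ "single (g, h, k)"]) auto
qed

text \<open>The signed shuffles of \<open>(a, b)\<close> with \<open>c\<close> bound the defect of
  additivity; their inner faces cancel because \<open>c\<close> commutes with \<open>a\<close> and
  \<open>b\<close>.\<close>

lemma commutator_chain_mult:
  assumes "a \<in> carrier G" "b \<in> carrier G" "c \<in> carrier G"
    and "a \<otimes>\<^bsub>G\<^esub> c = c \<otimes>\<^bsub>G\<^esub> a" "b \<otimes>\<^bsub>G\<^esub> c = c \<otimes>\<^bsub>G\<^esub> b"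
  shows "is_boundary2 G p (\<lambda>q. commutator_chain (a \<otimes>\<^bsub>G\<^esub> b) c q - (commutator_chain a c q + commutator_chain b c q))"
proof -
  have "is_boundary2 G p (\<lambda>q. face3 G (a, c, b) q - (face3 G (a, b, c) q + face3 G (c, a, b) q))"
    using assms by (intro is_boundary2_diff is_boundary2_add is_boundary2_face3)
  moreover have "(\<lambda>q. face3 G (a, c, b) q - (face3 G (a, b, c) q + face3 G (c, a, b) q)) =
    (\<lambda>q. commutator_chain (a \<otimes>\<^bsub>G\<^esub> b) c q - (commutator_chain a c q + commutator_chain b c q))"
    using assms(4,5) by (simp add: fun_eq_iff face3_def commutator_chain_def)
  ultimately show ?thesis by metis
qed

lemma commutator_chain_swap: "commutator_chain b a q = - commutator_chain a b q"
  by (simp add: commutator_chain_def)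

text \<open>The simplices \<open>(t, g, h)\<close>, \<open>(g', t, h)\<close>, \<open>(g', h', t)\<close> triangulate the prism between the
  2-simplex \<open>(g, h)\<close> and its conjugate \<open>(g', h')\<close>.\<close>

lemma commutator_chain_conj:
  assumes "t \<in> carrier G" "g \<in> carrier G" "h \<in> carrier G" "g' \<in> carrier G" "h' \<in> carrier G"
    and "t \<otimes>\<^bsub>G\<^esub> g = g' \<otimes>\<^bsub>G\<^esub> t" "t \<otimes>\<^bsub>G\<^esub> h = h' \<otimes>\<^bsub>G\<^esub> t"
    and "g \<otimes>\<^bsub>G\<^esub> h = h \<otimes>\<^bsub>G\<^esub> g" "g' \<otimes>\<^bsub>G\<^esub> h' = h' \<otimes>\<^bsub>G\<^esub> g'"
  shows "is_boundary2 G p (\<lambda>q. commutator_chain g h q - commutator_chain g' h' q)"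
proof -
  let ?prism = "\<lambda>g h g' h' q. face3 G (t, g, h) q - face3 G (g', t, h) q + face3 G (g', h', t) q"
  have "is_boundary2 G p (\<lambda>q. ?prism g h g' h' q - ?prism h g h' g' q)"
    using assms by (intro is_boundary2_diff is_boundary2_add is_boundary2_face3)
  moreover have "(\<lambda>q. ?prism g h g' h' q - ?prism h g h' g' q) =
      (\<lambda>q. commutator_chain g h q - commutator_chain g' h' q)"
    using assms(6-9) by (simp add: fun_eq_iff face3_def commutator_chain_def)
  ultimately show ?thesis by metis
qed

lemma supp_commutator_chain: "supp (commutator_chain a b) \<subseteq> {(a, b), (b, a)}"
  by (auto simp: supp_def commutator_chain_def single_def)

lemma finite_supp_commutator_chain: "finite (supp (commutator_chain a b))"
  using supp_commutator_chain by (rule finite_subset) simp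

lemma sum_supp_diff:
  fixes c :: "'x \<Rightarrow> int"
  assumes "finite (supp c)" "finite (supp c')"
  shows "(\<Sum>q\<in>supp (\<lambda>q. c q - c' q). (c q - c' q) * f q) =
         (\<Sum>q\<in>supp c. c q * f q) - (\<Sum>q\<in>supp c'. c' q * f q)"
proof -
  have "supp (\<lambda>q. - 1 * c' q) = supp c'" by (simp add: supp_def)
  then show ?thesis
    using sum_supp_add[of c "\<lambda>q. -1 * c' q" f] sum_supp_mult[of "-1" c' f] assms by simp
qed

lemma finite_supp_diff: "finite (supp c) \<Longrightarrow> finite (supp c') \<Longrightarrow> finite (supp (\<lambda>q. c q - c' q))"
  by (rule finite_subset[of _ "supp c \<union> supp c'"]) (auto simp: supp_def)

lemma sum_supp_commutator_chain:
  "(\<Sum>q\<in>supp (commutator_chain a b). commutator_chain a b q * f q) = f (a, b) - f (b, a)"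
  unfolding commutator_chain_def
  by (subst sum_supp_diff) (simp_all only: sum_supp_single, simp_all)

lemma push2_eq:
  "push2 G U z Q = (\<Sum>q\<in>supp z. z q * single (U #>\<^bsub>G\<^esub> fst q, U #>\<^bsub>G\<^esub> snd q) Q)"
  unfolding push2_def single_def by (rule sum.cong) auto

lemma push2_diff:
  "finite (supp z) \<Longrightarrow> finite (supp z') \<Longrightarrow>
   push2 G U (\<lambda>q. z q - z' q) Q = push2 G U z Q - push2 G U z' Q"
  unfolding push2_eq by (rule sum_supp_diff)

lemma push2_commutator_chain:
  "push2 G U (commutator_chain a b) Q = commutator_chain (U #>\<^bsub>G\<^esub> a) (U #>\<^bsub>G\<^esub> b) Q"
  by (simp add: push2_eq sum_supp_commutator_chain) (simp add: commutator_chain_def)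

lemma d2_diff:
  "finite (supp z) \<Longrightarrow> finite (supp z') \<Longrightarrow> d2 G (\<lambda>q. z q - z' q) y = d2 G z y - d2 G z' y"
  unfolding d2_def by (rule sum_supp_diff)

lemma d2_commutator_chain:
  "a \<otimes>\<^bsub>G\<^esub> b = b \<otimes>\<^bsub>G\<^esub> a \<Longrightarrow> d2 G (commutator_chain a b) y = 0"
  unfolding d2_def sum_supp_commutator_chain by simp

lemma chains2_commutator_chain:
  "a \<in> carrier G \<Longrightarrow> b \<in> carrier G \<Longrightarrow> commutator_chain a b \<in> chains2 G"
  using supp_commutator_chain[of a b] finite_supp_commutator_chain[of a b]
  by (auto simp: chains2_def)

lemma chains2_diff:
  "z \<in> chains2 G \<Longrightarrow> z' \<in> chains2 G \<Longrightarrow> (\<lambda>q. z q - z' q) \<in> chains2 G"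
proof -
  assume *: "z \<in> chains2 G" "z' \<in> chains2 G"
  have "supp (\<lambda>q. z q - z' q) \<subseteq> supp z \<union> supp z'" by (auto simp: supp_def)
  with * show ?thesis unfolding chains2_def by (auto intro: finite_subset)
qed

lemma is_cycle2_commutator_chain_diff:
  assumes "a \<in> carrier G" "b \<in> carrier G" "c \<in> carrier G" "d \<in> carrier G"
    and "a \<otimes>\<^bsub>G\<^esub> b = b \<otimes>\<^bsub>G\<^esub> a" "c \<otimes>\<^bsub>G\<^esub> d = d \<otimes>\<^bsub>G\<^esub> c"
  shows "is_cycle2 G p (\<lambda>q. commutator_chain a b q - commutator_chain c d q)"
  using assms
  by (simp add: is_cycle2_def chains2_diff chains2_commutator_chain d2_diff finite_supp_commutator_chain d2_commutator_chain)

text \<open>Summation by parts: pairing with \<open>d3\<close> amounts to pairing with the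
  coboundary. The cocycle identity is asked for only on the simplices of \<open>c\<close>, to suit a
  cochain built from a partially defined \<open>T\<close>.\<close>

lemma cocycle_pairing_boundary:
  fixes \<chi> :: "'a \<times> 'a \<Rightarrow> int"
  assumes "c \<in> chains3 G" and "\<And>y. p dvd (z y - d3 G c y)" and "finite (supp z)"
    and cocycle: "\<And>g h k. (g, h, k) \<in> supp c \<Longrightarrow>
      p dvd \<chi> (h, k) - \<chi> (g \<otimes>\<^bsub>G\<^esub> h, k) + \<chi> (g, h \<otimes>\<^bsub>G\<^esub> k) - \<chi> (g, h)"
  shows "p dvd (\<Sum>y\<in>supp z. z y * \<chi> y)"
proof -
  define faces where "faces = (\<lambda>(g, h, k). {(h, k), (g \<otimes>\<^bsub>G\<^esub> h, k), (g, h \<otimes>\<^bsub>G\<^esub> k), (g, h)})"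
  \<comment> \<open>A finite set carrying \<open>z\<close> and all faces of \<open>c\<close>, so
    that both sums can run over it and be exchanged.\<close>
  define S where "S = supp z \<union> (\<Union>q\<in>supp c. faces q)"
  have fc: "finite (supp c)" using assms(1) by (simp add: chains3_def)
  have S: "finite S" unfolding S_def using assms(3) fc by (auto simp: faces_def split: prod.splits)
  have one: "(\<Sum>y\<in>S. face3 G q y * \<chi> y) =
      (case q of (g, h, k) \<Rightarrow> \<chi> (h, k) - \<chi> (g \<otimes>\<^bsub>G\<^esub> h, k) + \<chi> (g, h \<otimes>\<^bsub>G\<^esub> k) - \<chi> (g, h))"
    if q: "q \<in> supp c" for q
  proof -
    obtain g h k where ghk: "q = (g, h, k)" by (cases q)
    have s: "(\<Sum>y\<in>S. single x y * \<chi> y) = \<chi> x" if "x \<in> S" for x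
    proof -
      have "(\<Sum>y\<in>S. single x y * \<chi> y) = (\<Sum>y\<in>S. if x = y then \<chi> y else 0)"
        by (rule sum.cong) (auto simp: single_def)
      then show ?thesis using that S by simp
    qed
    have "faces q \<subseteq> S" using q unfolding S_def by blast
    then have "(h, k) \<in> S" "(g \<otimes>\<^bsub>G\<^esub> h, k) \<in> S" "(g, h \<otimes>\<^bsub>G\<^esub> k) \<in> S" "(g, h) \<in> S"
      by (simp_all add: ghk faces_def)
    then show ?thesis
      by (simp add: ghk face3_def ring_distribs sum.distrib sum_subtractf s)
  qed
  have "(\<Sum>y\<in>supp z. z y * \<chi> y) = (\<Sum>y\<in>S. z y * \<chi> y)"
    using S by (intro sum.mono_neutral_left) (auto simp: S_def supp_def)
  also have "\<dots> = (\<Sum>y\<in>S. (z y - d3 G c y) * \<chi> y) + (\<Sum>y\<in>S. d3 G c y * \<chi> y)"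
    by (simp add: sum.distrib[symmetric] algebra_simps)
  finally have eq: "(\<Sum>y\<in>supp z. z y * \<chi> y) =
    (\<Sum>y\<in>S. (z y - d3 G c y) * \<chi> y) + (\<Sum>y\<in>S. d3 G c y * \<chi> y)" .
  have 1: "p dvd (\<Sum>y\<in>S. (z y - d3 G c y) * \<chi> y)"
    using assms(2) by (intro dvd_sum dvd_mult2)
  have "(\<Sum>y\<in>S. d3 G c y * \<chi> y) = (\<Sum>y\<in>S. \<Sum>q\<in>supp c. c q * (face3 G q y * \<chi> y))"
    by (simp add: d3_eq sum_distrib_right mult.assoc)
  also have "\<dots> = (\<Sum>q\<in>supp c. c q * (\<Sum>y\<in>S. face3 G q y * \<chi> y))"
    by (subst sum.swap) (simp add: sum_distrib_left)
  finally have 2: "p dvd (\<Sum>y\<in>S. d3 G c y * \<chi> y)"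
    using cocycle by (auto simp: one intro!: dvd_sum dvd_mult split: prod.splits)
  show ?thesis unfolding eq using 1 2 by (rule dvd_add)
qed

section \<open>Cycles in the kernel\<close>

definition homol :: "('a, 'b) monoid_scheme \<Rightarrow> int \<Rightarrow> ('a \<times> 'a \<Rightarrow> int) \<Rightarrow> ('a \<times> 'a \<Rightarrow> int) \<Rightarrow> bool" where
  "homol G p z z' \<longleftrightarrow> is_boundary2 G p (\<lambda>q. z q - z' q)"

lemma homol_refl: "homol G p z z"
  by (simp add: homol_def is_boundary2_dvd)

lemma homol_sym: "homol G p z z' \<Longrightarrow> homol G p z' z"
  unfolding homol_def by (drule is_boundary2_uminus) simp

lemma homol_trans: "homol G p z z' \<Longrightarrow> homol G p z' z'' \<Longrightarrow> homol G p z z''"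
  unfolding homol_def by (drule (1) is_boundary2_add) simp

lemma homol_add:
  "homol G p z z' \<Longrightarrow> homol G p w w' \<Longrightarrow> homol G p (\<lambda>q. z q + w q) (\<lambda>q. z' q + w' q)"
  unfolding homol_def by (drule (1) is_boundary2_add) (simp add: algebra_simps)

lemma homol_uminus: "homol G p z z' \<Longrightarrow> homol G p (\<lambda>q. - z q) (\<lambda>q. - z' q)"
  unfolding homol_def by (drule is_boundary2_uminus) simp

definition emb_left :: "int \<Rightarrow> int fps \<Rightarrow> dl_elem" where
  "emb_left p F = (red p F, \<lambda>_. 0, \<lambda>_. 0)"

definition emb_right :: "int \<Rightarrow> int fps \<Rightarrow> dl_elem" where
  "emb_right p F = (\<lambda>_. 0, red p F, \<lambda>_. 0)"

text \<open>The generator \<open>t\<close>. The residue is \<open>1 mod p ^ n\<close> rather than 1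
  because the entry at level 0 has to be 0.\<close>

definition dl_gen :: "int \<Rightarrow> dl_elem" where
  "dl_gen p = (\<lambda>_. 0, \<lambda>_. 0, \<lambda>n. 1 mod p ^ n)"

definition kernel_cycle :: "int \<Rightarrow> int fps \<Rightarrow> dl_elem \<times> dl_elem \<Rightarrow> int" where
  "kernel_cycle p F = (\<lambda>q. commutator_chain (emb_left p F) (emb_right p 1) q -
     commutator_chain (emb_left p 1) (emb_right p (twist F)) q)"

context prime_modulus
begin

section \<open>Multiplication in the group in terms of series\<close>

lemma DL_mult_red:
  "(red p F, red p G, a) \<otimes>\<^bsub>DL p\<^esub> (red p F', red p G', b) =
   (red p (F + tpow_fps p a * F'), red p (G + tpow_fps p a * G'), padd p a b)"
  by (simp add: DL_def DL_mult_def flip: red_tpow_fps)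

lemma DL_mult_zero:
  "(red p F, red p G, \<lambda>_. 0) \<otimes>\<^bsub>DL p\<^esub> (red p F', red p G', \<lambda>_. 0) =
   (red p (F + F'), red p (G + G'), \<lambda>_. 0)"
proof -
  have "red p (F + tpow_fps p (\<lambda>_. 0) * F') = red p (F + F')" for F F'
    using dvd_mult2[OF tpow_fps_0, of F'] by (simp add: red_eq_iff algebra_simps)
  then show ?thesis by (simp add: DL_mult_red padd_def)
qed

lemma emb_left_mult: "emb_left p F \<otimes>\<^bsub>DL p\<^esub> emb_left p G = emb_left p (F + G)"
  unfolding emb_left_def using DL_mult_zero[of F 0 G 0] by (simp add: red_def)

lemma emb_right_mult: "emb_right p F \<otimes>\<^bsub>DL p\<^esub> emb_right p G = emb_right p (F + G)"
  unfolding emb_right_def using DL_mult_zero[of 0 F 0 G] by (simp add: red_def)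

lemma emb_commute: "emb_left p F \<otimes>\<^bsub>DL p\<^esub> emb_right p G = emb_right p G \<otimes>\<^bsub>DL p\<^esub> emb_left p F"
  unfolding emb_left_def emb_right_def using DL_mult_zero[of F 0 0 G] DL_mult_zero[of 0 G F 0]
  by (simp add: red_def)

lemma one_mod_padic: "(\<lambda>n. 1 mod p ^ n) \<in> padic p"
  using p_gt_1 by (simp add: padic_def mod_mod_cancel)

lemma tpow_fps_dl_gen: "(of_int p :: int fps) dvd tpow_fps p (\<lambda>n. 1 mod p ^ n) - (1 - fps_X)"
proof (rule dvd_vanish_powers)
  fix n
  have "vanish p (nat p ^ n) ((1 - fps_X) ^ nat (1 mod p ^ n) - (1 - fps_X) ^ 1)"
    using p_gt_1 by (intro vanish_one_minus_X_cong) (simp add: nat_mod_distrib nat_power_eq)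
  with tpow_fps_approx[OF one_mod_padic, of n]
  show "vanish p (nat p ^ n) (tpow_fps p (\<lambda>n. 1 mod p ^ n) - (1 - fps_X))"
    using vanish_trans by (metis power_one_right)
qed

text \<open>The conjugation relation needed for \<open>commutator_chain_conj\<close>: the generator
  acts through \<open>y\<close> on both copies at once.\<close>

lemma dl_gen_mult_red:
  "dl_gen p \<otimes>\<^bsub>DL p\<^esub> (red p F, red p G, \<lambda>_. 0) =
   (red p ((1 - fps_X) * F), red p ((1 - fps_X) * G), \<lambda>_. 0) \<otimes>\<^bsub>DL p\<^esub> dl_gen p"
proof -
  have 1: "red p (0 + tpow_fps p (\<lambda>n. 1 mod p ^ n) * F) = red p ((1 - fps_X) * F + tpow_fps p (\<lambda>_. 0) * 0)" for F
    using dvd_mult2[OF tpow_fps_dl_gen, of F] by (simp add: red_eq_iff algebra_simps)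
  have gen: "dl_gen p = (red p 0, red p 0, \<lambda>n. 1 mod p ^ n)" by (simp add: dl_gen_def red_def)
  have comm: "padd p a (\<lambda>_. 0) = padd p (\<lambda>_. 0) a" for a by (simp add: padd_def)
  show ?thesis by (simp only: gen DL_mult_red 1 comm)
qed

lemma dl_gen_emb_left:
  "dl_gen p \<otimes>\<^bsub>DL p\<^esub> emb_left p F = emb_left p ((1 - fps_X) * F) \<otimes>\<^bsub>DL p\<^esub> dl_gen p"
  using dl_gen_mult_red[of F 0] by (simp add: emb_left_def red_def)

lemma dl_gen_emb_right:
  "dl_gen p \<otimes>\<^bsub>DL p\<^esub> emb_right p F = emb_right p ((1 - fps_X) * F) \<otimes>\<^bsub>DL p\<^esub> dl_gen p"
  using dl_gen_mult_red[of 0 F] by (simp add: emb_right_def red_def)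

lemma emb_left_carrier: "emb_left p F \<in> carrier (DL p)"
  and emb_right_carrier: "emb_right p F \<in> carrier (DL p)"
  and dl_gen_carrier: "dl_gen p \<in> carrier (DL p)"
  using p_gt_1 red_zpser[of p] zero_padic one_mod_padic
  by (simp_all add: emb_left_def emb_right_def dl_gen_def DL_def zpser_def)

lemma is_cycle2_kernel_cycle: "is_cycle2 (DL p) p (kernel_cycle p F)"
  unfolding kernel_cycle_def
  by (intro is_cycle2_commutator_chain_diff emb_left_carrier emb_right_carrier emb_commute)

section \<open>Balancing the pairing in the homology of an open quotient\<close>

context
  fixes U :: "dl_elem set" and n :: nat
  assumes U: "U \<lhd> DL p" and basic: "DL_basic p n \<subseteq> U"
begin

abbreviation Q where "Q \<equiv> DL p Mod U"
abbreviation cl where "cl x \<equiv> U #>\<^bsub>DL p\<^esub> x"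

definition pairing :: "int fps \<Rightarrow> int fps \<Rightarrow> dl_elem set \<times> dl_elem set \<Rightarrow> int" where
  "pairing F G = commutator_chain (cl (emb_left p F)) (cl (emb_right p G))"

text \<open>These are the scalars that can be moved across the tensor sign. They form a ring, and
  the aim is to show that it contains every series.\<close>

definition balanced :: "int fps \<Rightarrow> bool" where
  "balanced r \<longleftrightarrow> (\<forall>F G. homol Q p (pairing (r * F) G) (pairing F (twist r * G)))"

lemma cl_carrier: "x \<in> carrier (DL p) \<Longrightarrow> cl x \<in> carrier Q"
  by (simp add: carrier_FactGroup)

lemma cl_mult: "x \<in> carrier (DL p) \<Longrightarrow> y \<in> carrier (DL p) \<Longrightarrow> cl x \<otimes>\<^bsub>Q\<^esub> cl y = cl (x \<otimes>\<^bsub>DL p\<^esub> y)"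
  using normal.rcos_sum[OF U] by simp

lemmas emb_carrier = emb_left_carrier emb_right_carrier dl_gen_carrier

lemma pairing_add_left: "homol Q p (pairing (F + F') G) (\<lambda>q. pairing F G q + pairing F' G q)"
  unfolding homol_def pairing_def emb_left_mult[symmetric]
  by (subst cl_mult[symmetric])
    (intro emb_carrier commutator_chain_mult cl_carrier | simp add: cl_mult emb_carrier emb_commute del: mult_FactGroup)+

lemma pairing_add_right: "homol Q p (pairing F (G + G')) (\<lambda>q. pairing F G q + pairing F G' q)"
proof -
  \<comment> \<open>Additivity is available in the first argument only, so the arguments are
    exchanged, which costs a sign.\<close>
  have "is_boundary2 Q p (\<lambda>q. commutator_chain (cl (emb_right p G) \<otimes>\<^bsub>Q\<^esub> cl (emb_right p G')) (cl (emb_left p F)) q -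
     (commutator_chain (cl (emb_right p G)) (cl (emb_left p F)) q + commutator_chain (cl (emb_right p G')) (cl (emb_left p F)) q))"
    by (intro commutator_chain_mult cl_carrier emb_carrier)
      (simp_all add: cl_mult emb_carrier emb_commute del: mult_FactGroup)
  from is_boundary2_uminus[OF this] show ?thesis
    unfolding homol_def pairing_def
    by (simp add: cl_mult emb_carrier emb_right_mult commutator_chain_swap[of _ "cl (emb_left p F)"] algebra_simps
        del: mult_FactGroup)
qed

text \<open>Additivity for \<open>0 + 0\<close> makes this chain homologous to its own
  double.\<close>

lemma pairing_zero_left: "homol Q p (pairing 0 G) (\<lambda>_. 0)"
  using is_boundary2_uminus[OF pairing_add_left[of 0 0 G, unfolded homol_def]] by (simp add: homol_def)

lemma pairing_zero_right: "homol Q p (pairing F 0) (\<lambda>_. 0)"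
  using is_boundary2_uminus[OF pairing_add_right[of F 0 0, unfolded homol_def]] by (simp add: homol_def)

text \<open>The embedded elements lie in \<open>DL_basic p n\<close>, hence in \<open>U\<close>, so
  their cosets are trivial.\<close>

lemma cl_vanish:
  assumes "vanish p n F"
  shows "cl (emb_left p F) = cl (emb_left p 0)" "cl (emb_right p F) = cl (emb_right p 0)"
proof -
  have grp: "group (DL p)" and sub: "subgroup U (DL p)"
    using U by (simp_all add: normal_def normal_imp_subgroup)
  have *: "emb_left p F \<in> U \<and> emb_right p F \<in> U" if "vanish p n F" for F
    using that emb_left_carrier[of F] emb_right_carrier[of F] basic
    by (auto simp: DL_basic_def emb_left_def emb_right_def red_def vanish_def)
  have "vanish p n 0" by (simp add: vanish_def)
  with *[OF assms] *[of 0] show "cl (emb_left p F) = cl (emb_left p 0)" "cl (emb_right p F) = cl (emb_right p 0)"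
    by (simp_all add: subgroup.rcos_const[OF sub grp])
qed

lemma pairing_vanish_left: "vanish p n F \<Longrightarrow> homol Q p (pairing F G) (\<lambda>_. 0)"
  using pairing_zero_left[of G] by (simp add: pairing_def cl_vanish)

lemma pairing_vanish_right: "vanish p n G \<Longrightarrow> homol Q p (pairing F G) (\<lambda>_. 0)"
  using pairing_zero_right[of F] by (simp add: pairing_def cl_vanish)

lemma pairing_uminus_left: "homol Q p (pairing (- F) G) (\<lambda>q. - pairing F G q)"
proof -
  have "homol Q p (\<lambda>q. pairing F G q + pairing (- F) G q) (\<lambda>_. 0)"
    using homol_trans[OF homol_sym[OF pairing_add_left[of F "- F" G]]] pairing_zero_left by simp
  then show ?thesis by (simp add: homol_def add.commute)
qed

lemma pairing_uminus_right: "homol Q p (pairing F (- G)) (\<lambda>q. - pairing F G q)"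
proof -
  have "homol Q p (\<lambda>q. pairing F G q + pairing F (- G) q) (\<lambda>_. 0)"
    using homol_trans[OF homol_sym[OF pairing_add_right[of F G "- G"]]] pairing_zero_right by simp
  then show ?thesis by (simp add: homol_def add.commute)
qed

lemma balanced_vanish: "vanish p n r \<Longrightarrow> balanced r"
  unfolding balanced_def
  by (meson homol_trans homol_sym pairing_vanish_left pairing_vanish_right vanish_mult2 vanish_twist)

lemma balanced_one: "balanced 1"
  by (simp add: balanced_def homol_refl)

lemma balanced_add:
  assumes "balanced r" "balanced s"
  shows "balanced (r + s)"
  unfolding balanced_def
proof (intro allI)
  fix F G
  have "homol Q p (pairing (r * F + s * F) G) (\<lambda>q. pairing F (twist r * G) q + pairing F (twist s * G) q)"
    using homol_trans[OF pairing_add_left homol_add] assms unfolding balanced_def by blast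
  from homol_trans[OF this homol_sym[OF pairing_add_right]]
  show "homol Q p (pairing ((r + s) * F) G) (pairing F (twist (r + s) * G))"
    by (simp add: distrib_right twist_add)
qed

lemma balanced_uminus:
  assumes "balanced r"
  shows "balanced (- r)"
  unfolding balanced_def
proof (intro allI)
  fix F G
  have t: "twist (- r) = - twist r" using twist_diff[of 0 r] by simp
  have "homol Q p (pairing (- (r * F)) G) (\<lambda>q. - pairing F (twist r * G) q)"
    using homol_trans[OF pairing_uminus_left homol_uminus] assms unfolding balanced_def by blast
  from homol_trans[OF this homol_sym[OF pairing_uminus_right]]
  show "homol Q p (pairing (- r * F) G) (pairing F (twist (- r) * G))"
    by (simp add: t)
qed

lemma balanced_mult:
  assumes "balanced r" "balanced s"
  shows "balanced (r * s)"
  unfolding balanced_def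
proof (intro allI)
  fix F G
  have "homol Q p (pairing (r * (s * F)) G) (pairing F (twist s * (twist r * G)))"
    using homol_trans assms unfolding balanced_def by blast
  then show "homol Q p (pairing (r * s * F) G) (pairing F (twist (r * s) * G))"
    by (simp add: twist_mult mult_ac)
qed

text \<open>Conjugation by the generator multiplies both arguments by \<open>y\<close>. Applied to
  \<open>F\<close> and \<open>y^(-1) G\<close> it moves \<open>y\<close> to the other side.\<close>

lemma balanced_one_minus_X: "balanced (1 - fps_X)"
  unfolding balanced_def
proof (intro allI)
  fix F G :: "int fps"
  define G' where "G' = twist (1 - fps_X) * G"
  have G: "G = (1 - fps_X) * G'"
    using twist_one_minus_X by (simp add: G'_def flip: mult.assoc)
  have "is_boundary2 Q p (\<lambda>q. commutator_chain (cl (emb_left p F)) (cl (emb_right p G')) q -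
      commutator_chain (cl (emb_left p ((1 - fps_X) * F))) (cl (emb_right p ((1 - fps_X) * G'))) q)"
    by (rule commutator_chain_conj[where t = "cl (dl_gen p)"])
      (simp_all add: cl_carrier emb_carrier cl_mult dl_gen_emb_left dl_gen_emb_right emb_commute
        del: mult_FactGroup)
  then have "homol Q p (pairing F G') (pairing ((1 - fps_X) * F) G)"
    by (simp add: homol_def pairing_def G)
  then show "homol Q p (pairing ((1 - fps_X) * F) G) (pairing F (twist (1 - fps_X) * G))"
    unfolding G'_def by (rule homol_sym)
qed

lemma balanced_X_power: "balanced (fps_X ^ k)"
proof (induction k)
  case (Suc k)
  have "balanced (1 + - (1 - fps_X))"
    by (intro balanced_add balanced_uminus balanced_one balanced_one_minus_X)
  then show ?case using balanced_mult Suc by simp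
qed (simp add: balanced_one)

lemma balanced_of_int: "balanced (of_int c)"
proof -
  have *: "balanced (of_nat m)" for m
  proof (induction m)
    case 0
    show ?case using balanced_vanish[of 0] by (simp add: vanish_def)
  qed (simp add: balanced_add balanced_one)
  show ?thesis by (cases c rule: int_cases2) (simp_all add: * balanced_uminus)
qed

lemma balanced_sum: "finite A \<Longrightarrow> (\<And>i. i \<in> A \<Longrightarrow> balanced (r i)) \<Longrightarrow> balanced (sum r A)"
proof (induction A rule: finite_induct)
  case empty
  show ?case using balanced_vanish[of 0] by (simp add: vanish_def)
qed (simp add: balanced_add)

text \<open>Openness of \<open>U\<close> enters here: up to a tail that is trivial in the quotient,
  \<open>F\<close> is a polynomial in \<open>x = 1 - y\<close>.\<close>

lemma balanced_all: "balanced F"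
proof -
  define P :: "int fps" where "P = (\<Sum>k<n. of_int (F $ k) * fps_X ^ k)"
  have "balanced P" unfolding P_def
    by (intro balanced_sum balanced_mult balanced_of_int balanced_X_power) simp
  moreover have "balanced (F - P)"
    by (rule balanced_vanish) (auto simp: vanish_def P_def fps_sum_nth mult_delta_right simp flip: fps_of_int)
  ultimately have "balanced (P + (F - P))" by (rule balanced_add)
  then show ?thesis by simp
qed

lemma push2_kernel_cycle: "is_boundary2 Q p (push2 (DL p) U (kernel_cycle p F))"
proof -
  have "homol Q p (pairing (F * 1) 1) (pairing 1 (twist F * 1))"
    using balanced_all[of F] unfolding balanced_def by blast
  moreover have "push2 (DL p) U (kernel_cycle p F) = (\<lambda>q. pairing F 1 q - pairing 1 (twist F) q)"
    unfolding kernel_cycle_def pairing_def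
    by (rule ext) (simp add: push2_diff finite_supp_commutator_chain push2_commutator_chain)
  ultimately show ?thesis by (simp add: homol_def)
qed

end

lemma kernel_cycle_in_ker_phi_cycles: "kernel_cycle p F \<in> ker_phi_cycles (DL p) p (DL_open_normal p)"
  unfolding ker_phi_cycles_def DL_open_normal_def
  using is_cycle2_kernel_cycle push2_kernel_cycle by blast

text \<open>The bounding 3-chain involves finitely many group elements, so a single denominator
  \<open>s\<close> gives a map \<open>T\<close> defined on all their first components. The resulting
  cocycle has the values \<open>s * y^a\<close> and \<open>s * y^b\<close> on the two cycles, and
  \<open>s\<close> can be cancelled.\<close>

lemma kernel_cycles_not_homologous:
  assumes a: "a \<in> padic p" and b: "b \<in> padic p"
    and bd: "is_boundary2 (DL p) p (\<lambda>q. kernel_cycle p (tpow_fps p a * lacunary p) q - kernel_cycle p (tpow_fps p b * lacunary p) q)"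
  shows "a = b"
proof -
  define z where "z = (\<lambda>q. kernel_cycle p (tpow_fps p a * lacunary p) q - kernel_cycle p (tpow_fps p b * lacunary p) q)"
  obtain c where c: "c \<in> chains3 (DL p)" "\<And>y. p dvd (z y - d3 (DL p) c y)"
    using bd unfolding is_boundary2_def z_def by blast
  \<comment> \<open>The first components of all entries of \<open>c\<close>, where \<open>T\<close>
    has to be defined; 0 is added because elements of the second copy have first component
    0.\<close>
  define X where "X = insert 0 (\<Union>(g, h, k)\<in>supp c. {Abs_fps (fst g), Abs_fps (fst h), Abs_fps (fst k)})"
  have "finite X" using c(1) by (auto simp: X_def chains3_def)
  then obtain D T s where X: "X \<subseteq> D" and s: "\<not> (of_int p :: int fps) dvd s"
    and lin: "expsum_linear p D T" and D1: "1 \<in> D" and T1: "(of_int p :: int fps) dvd T 1"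
    and lacunary: "\<forall>a\<in>padic p. tpow_fps p a * lacunary p \<in> D \<and> (of_int p :: int fps) dvd T (tpow_fps p a * lacunary p) - s * tpow_fps p a"
    using discontinuous_linear_map by metis
  have Dadd: "F + G \<in> D" and Tadd: "(of_int p :: int fps) dvd T (F + G) - (T F + T G)"
    if "F \<in> D" "G \<in> D" for F G
    using lin that by (simp_all add: expsum_linear_def)
  have DY: "tpow_fps p a * F \<in> D" and TY: "(of_int p :: int fps) dvd T (tpow_fps p a * F) - tpow_fps p a * T F"
    if "a \<in> padic p" "F \<in> D" for a F
    using lin that by (simp_all add: expsum_linear_def)
  have Tcong: "(of_int p :: int fps) dvd T G - T F" if "F \<in> D" "(of_int p :: int fps) dvd G - F" for F G
    using lin that by (simp add: expsum_linear_def)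
  have Dlac: "tpow_fps p a * lacunary p \<in> D" and Tlac: "(of_int p :: int fps) dvd T (tpow_fps p a * lacunary p) - s * tpow_fps p a"
    if "a \<in> padic p" for a
    using lacunary that by simp_all
  \<comment> \<open>The cochain has power series as values; it is paired with chains one coefficient
    at a time.\<close>
  define \<chi> where "\<chi> = (\<lambda>(x :: dl_elem, y :: dl_elem).
    T (Abs_fps (fst x)) * twist (tpow_fps p (snd (snd x)) * Abs_fps (fst (snd y))))"
  have "cong_fps p (T (0 + 0)) (T 0 + T 0)" using Tadd[of 0 0] X by (simp add: X_def cong_fps_def)
  then have T0: "cong_fps p (T 0) 0" by (simp add: cong_fps_def)
  have TC: "cong_fps p (T (Abs_fps (red p F))) (T F)" if "F \<in> D" for F
    using Tcong[OF that] cong_fps_red[of p F] by (simp add: cong_fps_def)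
  have cocycle: "cong_fps p (\<chi> (h, k) - \<chi> (g \<otimes>\<^bsub>DL p\<^esub> h, k) + \<chi> (g, h \<otimes>\<^bsub>DL p\<^esub> k) - \<chi> (g, h)) 0"
    if ghk: "(g, h, k) \<in> supp c" for g h k
  proof -
    obtain f1 g1 a1 where g: "g = (f1, g1, a1)" by (cases g)
    obtain f2 g2 a2 where h: "h = (f2, g2, a2)" by (cases h)
    obtain f3 g3 a3 where k: "k = (f3, g3, a3)" by (cases k)
    have carr: "f1 \<in> zpser p" "g1 \<in> zpser p" "a1 \<in> padic p" "f2 \<in> zpser p" "g2 \<in> zpser p" "a2 \<in> padic p"
      "f3 \<in> zpser p" "g3 \<in> zpser p" "a3 \<in> padic p"
      using c(1) ghk by (auto simp: chains3_def DL_def g h k)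
    define F1 G1 F2 G2 F3 G3 where FG: "F1 = Abs_fps f1" "G1 = Abs_fps g1" "F2 = Abs_fps f2"
      "G2 = Abs_fps g2" "F3 = Abs_fps f3" "G3 = Abs_fps g3"
    have g': "g = (red p F1, red p G1, a1)" and h': "h = (red p F2, red p G2, a2)" and k': "k = (red p F3, red p G3, a3)"
      by (simp_all add: g h k FG red_Abs_fps carr)
    have FD: "F1 \<in> D" "F2 \<in> D" using X ghk by (force simp: X_def g h k FG)+
    let ?t1 = "twist (tpow_fps p a1)" and ?t2 = "twist (tpow_fps p a2)"
    have "cong_fps p (T (Abs_fps (red p (F1 + tpow_fps p a1 * F2)))) (T (F1 + tpow_fps p a1 * F2))"
      using TC Dadd[OF FD(1) DY[OF carr(3) FD(2)]] .
    also have "cong_fps p (T (F1 + tpow_fps p a1 * F2)) (T F1 + T (tpow_fps p a1 * F2))"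
      using Tadd[OF FD(1) DY[OF carr(3) FD(2)]] by (simp add: cong_fps_def)
    also have "cong_fps p (T F1 + T (tpow_fps p a1 * F2)) (T F1 + tpow_fps p a1 * T F2)"
      using TY[OF carr(3) FD(2)] by (intro cong_fps_add cong_fps_refl) (simp add: cong_fps_def)
    finally have E1: "cong_fps p (T (Abs_fps (red p (F1 + tpow_fps p a1 * F2)))) (T F1 + tpow_fps p a1 * T F2)" .
    have E2: "cong_fps p (twist (tpow_fps p (padd p a1 a2))) (?t1 * ?t2)"
      using cong_fps_twist[of p "tpow_fps p (padd p a1 a2)" "tpow_fps p a1 * tpow_fps p a2"] tpow_fps_padd[OF carr(3,6)]
      by (simp add: cong_fps_def twist_mult)
    have E3: "cong_fps p (twist (Abs_fps (red p (G2 + tpow_fps p a2 * G3)))) (twist G2 + ?t2 * twist G3)"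
      using cong_fps_twist[OF cong_fps_red, of p "G2 + tpow_fps p a2 * G3"] by (simp add: twist_add twist_mult)
    \<comment> \<open>The decisive cancellation: the factor \<open>y^a1\<close> that linearity takes
      out of \<open>T\<close> for the product of \<open>g\<close> and \<open>h\<close> is undone by
      the twisted factor in front of \<open>twist G3\<close>.\<close>
    have E4: "cong_fps p (tpow_fps p a1 * ?t1) 1" using tpow_fps_twist[OF carr(3)] by (simp add: cong_fps_def)
    have hk: "\<chi> (h, k) = T F2 * (?t2 * twist G3)"
      by (simp add: \<chi>_def h k FG twist_mult)
    have gh: "\<chi> (g, h) = T F1 * (?t1 * twist G2)"
      by (simp add: \<chi>_def g h FG twist_mult)
    have gh_k: "\<chi> (g \<otimes>\<^bsub>DL p\<^esub> h, k) = T (Abs_fps (red p (F1 + tpow_fps p a1 * F2))) * (twist (tpow_fps p (padd p a1 a2)) * twist G3)"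
      unfolding g' h' DL_mult_red by (simp add: \<chi>_def k FG twist_mult)
    have g_hk: "\<chi> (g, h \<otimes>\<^bsub>DL p\<^esub> k) = T F1 * (?t1 * twist (Abs_fps (red p (G2 + tpow_fps p a2 * G3))))"
      unfolding h' k' DL_mult_red by (simp add: \<chi>_def g FG twist_mult)
    have "cong_fps p (\<chi> (g \<otimes>\<^bsub>DL p\<^esub> h, k)) ((T F1 + tpow_fps p a1 * T F2) * (?t1 * ?t2 * twist G3))"
      unfolding gh_k by (intro cong_fps_mult E1 E2 cong_fps_refl)
    also have "(T F1 + tpow_fps p a1 * T F2) * (?t1 * ?t2 * twist G3) =
        T F1 * ?t1 * ?t2 * twist G3 + (tpow_fps p a1 * ?t1) * (T F2 * ?t2 * twist G3)"
      by (simp add: algebra_simps)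
    also have "cong_fps p \<dots> (T F1 * ?t1 * ?t2 * twist G3 + 1 * (T F2 * ?t2 * twist G3))"
      by (intro cong_fps_add cong_fps_mult E4 cong_fps_refl)
    finally have 1: "cong_fps p (\<chi> (g \<otimes>\<^bsub>DL p\<^esub> h, k)) (T F1 * ?t1 * ?t2 * twist G3 + 1 * (T F2 * ?t2 * twist G3))" .
    have 2: "cong_fps p (\<chi> (g, h \<otimes>\<^bsub>DL p\<^esub> k)) (T F1 * (?t1 * (twist G2 + ?t2 * twist G3)))"
      unfolding g_hk by (intro cong_fps_mult E3 cong_fps_refl)
    have "cong_fps p (\<chi> (h, k) - \<chi> (g \<otimes>\<^bsub>DL p\<^esub> h, k) + \<chi> (g, h \<otimes>\<^bsub>DL p\<^esub> k) - \<chi> (g, h))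
      (\<chi> (h, k) - (T F1 * ?t1 * ?t2 * twist G3 + 1 * (T F2 * ?t2 * twist G3)) +
       T F1 * (?t1 * (twist G2 + ?t2 * twist G3)) - \<chi> (g, h))"
      by (intro cong_fps_add cong_fps_diff 1 2 cong_fps_refl)
    also have "\<chi> (h, k) - (T F1 * ?t1 * ?t2 * twist G3 + 1 * (T F2 * ?t2 * twist G3)) +
       T F1 * (?t1 * (twist G2 + ?t2 * twist G3)) - \<chi> (g, h) = 0"
      unfolding hk gh by (simp add: algebra_simps)
    finally show ?thesis .
  qed
  have fin: "finite (supp (kernel_cycle p F))" for F
    unfolding kernel_cycle_def by (intro finite_supp_diff finite_supp_commutator_chain)
  have vanish: "p dvd (\<Sum>y\<in>supp z. z y * \<chi> y $ n)" for n
  proof (rule cocycle_pairing_boundary[OF c])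
    show "finite (supp z)" unfolding z_def by (intro finite_supp_diff fin)
    show "p dvd \<chi> (h, k) $ n - \<chi> (g \<otimes>\<^bsub>DL p\<^esub> h, k) $ n + \<chi> (g, h \<otimes>\<^bsub>DL p\<^esub> k) $ n - \<chi> (g, h) $ n"
      if "(g, h, k) \<in> supp c" for g h k
      using cocycle[OF that] by (simp add: cong_fps_def of_int_dvd_fps_iff)
  qed
  \<comment> \<open>Of the four values only the first survives modulo \<open>p\<close>: the second
    and the fourth contain \<open>T 0\<close>, the third contains \<open>T 1\<close>.\<close>
  define v where "v F = \<chi> (emb_left p F, emb_right p 1) - \<chi> (emb_right p 1, emb_left p F) -
    (\<chi> (emb_left p 1, emb_right p (twist F)) - \<chi> (emb_right p (twist F), emb_left p 1))" for F
  have kc: "(\<Sum>y\<in>supp (kernel_cycle p F). kernel_cycle p F y * \<chi> y $ n) = v F $ n" for F n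
    unfolding kernel_cycle_def
    by (subst sum_supp_diff) (simp_all add: finite_supp_commutator_chain sum_supp_commutator_chain v_def)
  have "(\<Sum>y\<in>supp z. z y * \<chi> y $ n) = (v (tpow_fps p a * lacunary p) - v (tpow_fps p b * lacunary p)) $ n" for n
    unfolding z_def by (subst sum_supp_diff) (simp_all add: fin kc)
  then have veq: "cong_fps p (v (tpow_fps p a * lacunary p)) (v (tpow_fps p b * lacunary p))"
    using vanish by (simp add: cong_fps_def of_int_dvd_fps_iff)
  have v: "cong_fps p (v (tpow_fps p d * lacunary p)) (s * tpow_fps p d)" if d: "d \<in> padic p" for d
  proof -
    let ?F = "tpow_fps p d * lacunary p"
    have T1': "cong_fps p (T 1) 0" using T1 by (simp add: cong_fps_def)
    have zero: "Abs_fps (\<lambda>_. 0) = (0 :: int fps)" by (simp add: fps_eq_iff)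
    have "cong_fps p (\<chi> (emb_left p ?F, emb_right p 1)) (s * tpow_fps p d * twist (1 * 1))"
      unfolding \<chi>_def emb_left_def emb_right_def prod.case fst_conv snd_conv
    proof (intro cong_fps_mult cong_fps_twist cong_fps_red)
      show "cong_fps p (T (Abs_fps (red p ?F))) (s * tpow_fps p d)"
        using cong_fps_trans[OF TC[OF Dlac[OF d]]] Tlac[OF d] by (simp add: cong_fps_def)
      show "cong_fps p (tpow_fps p (\<lambda>_. 0)) 1" using tpow_fps_0 by (simp add: cong_fps_def)
    qed
    moreover have "cong_fps p (\<chi> (emb_right p G, y)) (0 * twist (tpow_fps p (snd (snd (emb_right p G))) * Abs_fps (fst (snd y))))" for G y
      unfolding \<chi>_def emb_right_def prod.case fst_conv zero by (intro cong_fps_mult T0 cong_fps_refl)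
    then have "cong_fps p (\<chi> (emb_right p G, y)) 0" for G y by simp
    moreover have "cong_fps p (\<chi> (emb_left p 1, y)) (0 * twist (tpow_fps p (snd (snd (emb_left p 1))) * Abs_fps (fst (snd y))))" for y
      unfolding \<chi>_def prod.case
    proof (intro cong_fps_mult cong_fps_refl)
      show "cong_fps p (T (Abs_fps (fst (emb_left p 1)))) 0"
        using cong_fps_trans[OF TC[OF D1] T1'] by (simp add: emb_left_def)
    qed
    then have "cong_fps p (\<chi> (emb_left p 1, y)) 0" for y by simp
    ultimately have "cong_fps p (v ?F) (s * tpow_fps p d * twist (1 * 1) - 0 - (0 - 0))"
      unfolding v_def by (intro cong_fps_diff)
    then show ?thesis by simp
  qed
  have "cong_fps p (s * tpow_fps p a) (s * tpow_fps p b)"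
    using cong_fps_trans[OF cong_fps_sym[OF v[OF a]] cong_fps_trans[OF veq v[OF b]]] .
  then have "(of_int p :: int fps) dvd s * (tpow_fps p a - tpow_fps p b)" by (simp add: cong_fps_def algebra_simps)
  then have "(of_int p :: int fps) dvd tpow_fps p a - tpow_fps p b" using prime_dvd_fps_mult s by blast
  then show "a = b" by (rule tpow_fps_inj[OF a b])
qed

section \<open>Counting the classes\<close>

lemma uncountable_padic: "\<not> countable (padic p)"
proof
  assume "countable (padic p)"
  \<comment> \<open>Sets of naturals are encoded by \<open>p\<close>-adic integers with digits 0 and
    1; \<open>d S n\<close> is the residue modulo \<open>p^n\<close>.\<close>
  define d where "d S n = (\<Sum>i<n. if i \<in> S then p ^ i else 0)" for S :: "nat set" and n
  have d0: "0 \<le> d S n" and d1: "d S n < p ^ n" for S n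
  proof -
    show "0 \<le> d S n" unfolding d_def using p_gt_1 by (intro sum_nonneg) auto
    show "d S n < p ^ n"
    proof (induction n)
      case (Suc n)
      have "d S (Suc n) \<le> d S n + p ^ n" using p_gt_1 by (simp add: d_def)
      also have "\<dots> < 2 * p ^ n" using Suc by simp
      also have "\<dots> \<le> p * p ^ n" using p_gt_1 by (intro mult_right_mono) auto
      finally show ?case by simp
    qed (simp add: d_def)
  qed
  have "d S (Suc n) mod p ^ n = d S n" for S n
  proof -
    have "d S (Suc n) mod p ^ n = d S n mod p ^ n" by (simp add: d_def)
    then show ?thesis using d0 d1 by simp
  qed
  then have range: "range d \<subseteq> padic p" using d0 d1 by (auto simp: padic_def)
  have "inj d"
  proof (rule injI)
    fix S S' assume e: "d S = d S'"
    have "i \<in> S \<longleftrightarrow> i \<in> S'" for i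
    proof -
      \<comment> \<open>Consecutive residues differ by digit \<open>i\<close> times
        \<open>p^i\<close>, which recovers the set.\<close>
      have "d S (Suc i) - d S i = d S' (Suc i) - d S' i" using e by simp
      then show ?thesis using p_gt_1 by (auto simp: d_def split: if_splits)
    qed
    then show "S = S'" by blast
  qed
  then have "countable (UNIV :: nat set set)"
    using countable_subset[OF range \<open>countable (padic p)\<close>] countable_image_inj_on by blast
  then obtain f :: "nat \<Rightarrow> nat set" where "surj f"
    by (metis UNIV_not_empty uncountable_def)
  then show False using Cantors_theorem[of UNIV] by auto
qed

end

theorem theorem4p3:
  fixes p :: int
  assumes "prime p"
  shows "\<not> countable (ker_phi (DL p) p (DL_open_normal p))"
proof
  interpret prime_modulus p
    using assms by unfold_locales
  assume cnt: "countable (ker_phi (DL p) p (DL_open_normal p))"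
  let ?K = "ker_phi_cycles (DL p) p (DL_open_normal p)"
  define z where "z a = kernel_cycle p (tpow_fps p a * lacunary p)" for a
  define cls where "cls a = homologous2 (DL p) p ?K `` {z a}" for a
  have z: "z a \<in> ?K" for a
    unfolding z_def by (rule kernel_cycle_in_ker_phi_cycles)
  have "inj_on cls (padic p)"
  proof (rule inj_onI)
    fix a b assume ab: "a \<in> padic p" "b \<in> padic p" and "cls a = cls b"
    \<comment> \<open>By reflexivity each cycle lies in its own class, so equality of the two
      classes yields a boundary.\<close>
    have "z b \<in> cls b" using z by (simp add: cls_def homologous2_def is_boundary2_dvd)
    then have "z b \<in> cls a" using \<open>cls a = cls b\<close> by simp
    then have "is_boundary2 (DL p) p (\<lambda>q. z a q - z b q)" by (simp add: cls_def homologous2_def)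
    then show "a = b" unfolding z_def by (rule kernel_cycles_not_homologous[OF ab])
  qed
  moreover have "cls ` padic p \<subseteq> ker_phi (DL p) p (DL_open_normal p)"
    using z by (auto simp: cls_def ker_phi_def intro: quotientI)
  ultimately have "countable (padic p)"
    using cnt countable_subset countable_image_inj_on by blast
  then show False using uncountable_padic by blast
qed

end
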